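(* Let $E$ be an energy form on $L^0(m)$. The following assertions are equivalent. (i) $E$ is transient, i.e. $\ker E=\{0\}$. (ii) The embedding $(D(E),\|\cdot\|_E)\to(L^0(m),\tau(m))$, $f\mapsto f$, is continuous. (iii) $(D(E),E)$ is a Hilbert space.
   Context: $(X,\mathcal B,m)$ is a measure space with $m$ localizable: $m$ is semi-finite and every family $\mathcal A\subseteq\mathcal B$ has an essential supremum $S\in\mathcal B$, i.e. $m(A\setminus S)=0$ for all $A\in\mathcal A$, and $m(S\setminus G)=0$ whenever $G\in\mathcal B$ satisfies $m(A\setminus G)=0$ for all $A\in\mathcal A$. $L^0(m)$ is the space of real-valued measurable functions modulo $m$-a.e. equality, with the topology $\tau(m)$ of local convergence in measure: $f_i\to f$ iff $\int_U|f_i-f|\wedge1\,dm\to0$ for every measurable $U$ with $m(U)<\infty$. A quadratic form on $L^0(m)$ is a map $q:L^0(m)\to[0,\infty]$ with $2q(u)+2q(v)=q(u+v)+q(u-v)$ and $q(\lambda u)=|\lambda|^2q(u)$ ($0\cdot\infty=0$); $D(q)=\{q<\infty\}$, $\ker q=\{q=0\}$, $\|u\|_q=q(u)^{1/2}$, and $q(u,v)=\frac14(q(u+v)-q(u-v))$ is the induced bilinear form on $D(q)$. It is closed if $D(q)$ is complete in the form topology, the smallest topology containing the subspace topology of $\tau(m)$ and the topology of the seminorm $\|\cdot\|_q$. An $\varepsilon$-cutoff is a monotone increasing map $C:\mathbb R\to[-\varepsilon,1+\varepsilon]$ with $|C(x)-C(y)|\le|x-y|$ and $C(x)=x$ for $x\in[0,1]$.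 A quadratic form $E$ on $L^0(m)$ is Markovian if for each $\varepsilon>0$ there is an $\varepsilon$-cutoff $C_\varepsilon$ with $E(C_\varepsilon\circ f)\le E(f)$ for all $f\in L^0(m)$; an energy form is a closed Markovian form on $L^0(m)$. *)

theory Defs
  imports "HOL-Analysis.Analysis"
begin

section \<open>Localizable measures\<close>

text \<open>
  The condition \<open>0 < emeasure M B\<close> is essential: the library locale \<open>semifinite_measure\<close>
  omits it and therefore holds for every measure (take \<open>B = {}\<close>).
\<close>

definition semi_finite :: "'a measure \<Rightarrow> bool" where
  "semi_finite M \<longleftrightarrow>
     (\<forall>A\<in>sets M. emeasure M A = \<infinity> \<longrightarrow>
        (\<exists>B\<in>sets M. B \<subseteq> A \<and> 0 < emeasure M B \<and> emeasure M B < \<infinity>))"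

definition essential_supremum :: "'a measure \<Rightarrow> 'a set set \<Rightarrow> 'a set \<Rightarrow> bool" where
  "essential_supremum M \<A> S \<longleftrightarrow>
     S \<in> sets M \<and>
     (\<forall>A\<in>\<A>. emeasure M (A - S) = 0) \<and>
     (\<forall>G\<in>sets M. (\<forall>A\<in>\<A>. emeasure M (A - G) = 0) \<longrightarrow> emeasure M (S - G) = 0)"

definition localizable :: "'a measure \<Rightarrow> bool" where
  "localizable M \<longleftrightarrow> semi_finite M \<and> (\<forall>\<A>. \<A> \<subseteq> sets M \<longrightarrow> (\<exists>S. essential_supremum M \<A> S))"


section \<open>The space $L^0(m)$\<close>

text \<open>
  Elements of \<open>L0 M\<close> are equivalence classes of measurable functions.  Functions are total on the
  type \<open>'a\<close>, but measurability and a.e. equality only see their values on \<open>space M\<close>.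
\<close>

definition ae_eq :: "'a measure \<Rightarrow> (('a \<Rightarrow> real) \<times> ('a \<Rightarrow> real)) set" where
  "ae_eq M = {(f, g). f \<in> borel_measurable M \<and> g \<in> borel_measurable M \<and> (AE x in M. f x = g x)}"

definition L0 :: "'a measure \<Rightarrow> ('a \<Rightarrow> real) set set" where
  "L0 M = borel_measurable M // ae_eq M"

definition L0_class :: "'a measure \<Rightarrow> ('a \<Rightarrow> real) \<Rightarrow> ('a \<Rightarrow> real) set" where
  "L0_class M f = ae_eq M `` {f}"

definition L0_rep :: "('a \<Rightarrow> real) set \<Rightarrow> 'a \<Rightarrow> real" where
  "L0_rep u = (SOME f. f \<in> u)"

text \<open>
  The operations below are defined through representatives; the lemmas at the end of this section
  show that they do not depend on the choice.
\<close>

definition L0_zero :: "'a measure \<Rightarrow> ('a \<Rightarrow> real) set" where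
  "L0_zero M = L0_class M (\<lambda>x. 0)"

definition L0_add :: "'a measure \<Rightarrow> ('a \<Rightarrow> real) set \<Rightarrow> ('a \<Rightarrow> real) set \<Rightarrow> ('a \<Rightarrow> real) set" where
  "L0_add M u v = L0_class M (\<lambda>x. L0_rep u x + L0_rep v x)"

definition L0_diff :: "'a measure \<Rightarrow> ('a \<Rightarrow> real) set \<Rightarrow> ('a \<Rightarrow> real) set \<Rightarrow> ('a \<Rightarrow> real) set" where
  "L0_diff M u v = L0_class M (\<lambda>x. L0_rep u x - L0_rep v x)"

definition L0_scale :: "'a measure \<Rightarrow> real \<Rightarrow> ('a \<Rightarrow> real) set \<Rightarrow> ('a \<Rightarrow> real) set" where
  "L0_scale M c u = L0_class M (\<lambda>x. c * L0_rep u x)"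

definition L0_comp :: "'a measure \<Rightarrow> (real \<Rightarrow> real) \<Rightarrow> ('a \<Rightarrow> real) set \<Rightarrow> ('a \<Rightarrow> real) set" where
  "L0_comp M C u = L0_class M (C \<circ> L0_rep u)"

definition L0_dist :: "'a measure \<Rightarrow> 'a set \<Rightarrow> ('a \<Rightarrow> real) set \<Rightarrow> ('a \<Rightarrow> real) set \<Rightarrow> real" where
  "L0_dist M U u v = (LINT x:U|M. min \<bar>L0_rep u x - L0_rep v x\<bar> 1)"

lemma equiv_ae_eq: "equiv (borel_measurable M) (ae_eq M)"
proof (rule equivI)
  show "trans (ae_eq M)"
  proof (rule transI)
    fix f g h
    assume fg: "(f, g) \<in> ae_eq M" and gh: "(g, h) \<in> ae_eq M"
    hence "AE x in M. f x = g x" "AE x in M. g x = h x"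
      by (auto simp: ae_eq_def)
    hence "AE x in M. f x = h x" by eventually_elim simp
    thus "(f, h) \<in> ae_eq M" using fg gh by (auto simp: ae_eq_def)
  qed
qed (auto simp: ae_eq_def refl_on_def sym_def eq_commute)

lemma L0_class_in_L0: "f \<in> borel_measurable M \<Longrightarrow> L0_class M f \<in> L0 M"
  by (auto simp: L0_class_def L0_def intro: quotientI)

lemma L0_class_eqI:
  assumes "f \<in> borel_measurable M" "g \<in> borel_measurable M" "AE x in M. f x = g x"
  shows "L0_class M f = L0_class M g"
  unfolding L0_class_def
  by (rule equiv_class_eq[OF equiv_ae_eq]) (use assms in \<open>auto simp: ae_eq_def\<close>)

lemma L0_rep_class:
  assumes "f \<in> borel_measurable M"
  shows "L0_rep (L0_class M f) \<in> borel_measurable M" "AE x in M. L0_rep (L0_class M f) x = f x"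
proof -
  have "f \<in> L0_class M f"
    using assms by (auto simp: L0_class_def ae_eq_def)
  hence "L0_rep (L0_class M f) \<in> L0_class M f"
    unfolding L0_rep_def by (rule someI[of "\<lambda>g. g \<in> _"])
  thus "L0_rep (L0_class M f) \<in> borel_measurable M" "AE x in M. L0_rep (L0_class M f) x = f x"
    by (auto simp: L0_class_def ae_eq_def eq_commute)
qed

lemma L0_cases:
  assumes "u \<in> L0 M"
  obtains f where "f \<in> borel_measurable M" "u = L0_class M f"
  using assms unfolding L0_def L0_class_def by (rule quotientE)

lemma L0_rep_measurable: "u \<in> L0 M \<Longrightarrow> L0_rep u \<in> borel_measurable M"
  by (erule L0_cases) (simp add: L0_rep_class(1))

lemma L0_class_rep:
  assumes "u \<in> L0 M"
  shows "L0_class M (L0_rep u) = u"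
proof -
  obtain f where f: "f \<in> borel_measurable M" "u = L0_class M f"
    using assms by (rule L0_cases)
  show ?thesis
    unfolding f(2) by (rule L0_class_eqI[OF L0_rep_class(1)[OF f(1)] f(1) L0_rep_class(2)[OF f(1)]])
qed

context
  fixes M :: "'a measure" and f g :: "'a \<Rightarrow> real"
  assumes f: "f \<in> borel_measurable M" and g: "g \<in> borel_measurable M"
begin

lemma L0_add_class: "L0_add M (L0_class M f) (L0_class M g) = L0_class M (\<lambda>x. f x + g x)"
  unfolding L0_add_def
proof (rule L0_class_eqI)
  show "AE x in M. L0_rep (L0_class M f) x + L0_rep (L0_class M g) x = f x + g x"
    using L0_rep_class(2)[OF f] L0_rep_class(2)[OF g] by eventually_elim simp
qed (use L0_rep_class(1)[OF f] L0_rep_class(1)[OF g] f g in auto)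

lemma L0_diff_class: "L0_diff M (L0_class M f) (L0_class M g) = L0_class M (\<lambda>x. f x - g x)"
  unfolding L0_diff_def
proof (rule L0_class_eqI)
  show "AE x in M. L0_rep (L0_class M f) x - L0_rep (L0_class M g) x = f x - g x"
    using L0_rep_class(2)[OF f] L0_rep_class(2)[OF g] by eventually_elim simp
qed (use L0_rep_class(1)[OF f] L0_rep_class(1)[OF g] f g in auto)

lemma L0_scale_class: "L0_scale M c (L0_class M f) = L0_class M (\<lambda>x. c * f x)"
  unfolding L0_scale_def
proof (rule L0_class_eqI)
  show "AE x in M. c * L0_rep (L0_class M f) x = c * f x"
    using L0_rep_class(2)[OF f] by eventually_elim simp
qed (use L0_rep_class(1)[OF f] f in auto)

lemma L0_comp_class:
  assumes C: "C \<in> borel_measurable borel"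
  shows "L0_comp M C (L0_class M f) = L0_class M (C \<circ> f)"
  unfolding L0_comp_def
proof (rule L0_class_eqI)
  show "AE x in M. (C \<circ> L0_rep (L0_class M f)) x = (C \<circ> f) x"
    using L0_rep_class(2)[OF f] by eventually_elim simp
qed (use L0_rep_class(1)[OF f] f C in \<open>auto intro: measurable_comp\<close>)

lemma L0_dist_class:
  assumes [measurable]: "U \<in> sets M"
  shows "L0_dist M U (L0_class M f) (L0_class M g) = (LINT x:U|M. min \<bar>f x - g x\<bar> 1)"
  unfolding L0_dist_def set_lebesgue_integral_def
proof (rule integral_cong_AE)
  note [measurable] = f g L0_rep_class(1)[OF f] L0_rep_class(1)[OF g]
  show "(\<lambda>x. indicat_real U x *\<^sub>R min \<bar>L0_rep (L0_class M f) x - L0_rep (L0_class M g) x\<bar> 1)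
      \<in> borel_measurable M"
    by measurable
  show "(\<lambda>x. indicat_real U x *\<^sub>R min \<bar>f x - g x\<bar> 1) \<in> borel_measurable M"
    by measurable
  show "AE x in M. indicat_real U x *\<^sub>R min \<bar>L0_rep (L0_class M f) x - L0_rep (L0_class M g) x\<bar> 1
      = indicat_real U x *\<^sub>R min \<bar>f x - g x\<bar> 1"
    using L0_rep_class(2)[OF f] L0_rep_class(2)[OF g] by eventually_elim simp
qed

end


section \<open>Local convergence in measure\<close>

definition L0_topology :: "'a measure \<Rightarrow> ('a \<Rightarrow> real) set topology" where
  "L0_topology M = topology_generated_by
     {{v \<in> L0 M. L0_dist M U u v < e} | u U e. u \<in> L0 M \<and> U \<in> sets M \<and> emeasure M U < \<infinity> \<and> 0 < e}"

lemma L0_dist_integrable: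
  assumes "u \<in> L0 M" "v \<in> L0 M" "U \<in> sets M" "emeasure M U < \<infinity>"
  shows "set_integrable M U (\<lambda>x. min \<bar>L0_rep u x - L0_rep v x\<bar> 1)"
  unfolding set_integrable_def
proof (rule Bochner_Integration.integrable_bound)
  show "integrable M (indicat_real U)"
    using assms by (intro integrable_real_indicator) auto
  note [measurable] = L0_rep_measurable[OF assms(1)] L0_rep_measurable[OF assms(2)] assms(3)
  show "(\<lambda>x. indicat_real U x *\<^sub>R min \<bar>L0_rep u x - L0_rep v x\<bar> 1) \<in> borel_measurable M"
    by measurable
qed (auto simp: indicator_def)

lemma L0_dist_commute: "L0_dist M U u v = L0_dist M U v u"
  by (simp add: L0_dist_def abs_minus_commute)

lemma L0_dist_nonneg: "0 \<le> L0_dist M U u v"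
  unfolding L0_dist_def set_lebesgue_integral_def by (intro integral_nonneg_AE) auto

lemma L0_dist_self: "L0_dist M U u u = 0"
  by (simp add: L0_dist_def)

lemma L0_dist_triangle:
  assumes "u \<in> L0 M" "v \<in> L0 M" "w \<in> L0 M" "U \<in> sets M" "emeasure M U < \<infinity>"
  shows "L0_dist M U u w \<le> L0_dist M U u v + L0_dist M U v w"
proof -
  note i = L0_dist_integrable[OF _ _ assms(4,5)]
  have "L0_dist M U u w \<le> (LINT x:U|M. min \<bar>L0_rep u x - L0_rep v x\<bar> 1 + min \<bar>L0_rep v x - L0_rep w x\<bar> 1)"
    unfolding L0_dist_def
    by (rule set_integral_mono) (use assms in \<open>auto intro!: i set_integral_add\<close>)
  also have "\<dots> = L0_dist M U u v + L0_dist M U v w"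
    unfolding L0_dist_def by (rule set_integral_add) (use assms in \<open>auto intro: i\<close>)
  finally show ?thesis .
qed

lemma openin_L0_topology_ball:
  "u \<in> L0 M \<Longrightarrow> U \<in> sets M \<Longrightarrow> emeasure M U < \<infinity> \<Longrightarrow> 0 < e \<Longrightarrow>
     openin (L0_topology M) {v \<in> L0 M. L0_dist M U u v < e}"
  unfolding L0_topology_def by (rule topology_generated_by_Basis) blast

lemma topspace_L0_topology: "topspace (L0_topology M) = L0 M"
proof
  show "L0 M \<subseteq> topspace (L0_topology M)"
  proof
    fix u assume u: "u \<in> L0 M"
    show "u \<in> topspace (L0_topology M)"
      using openin_subset[OF openin_L0_topology_ball[OF u, of "{}" 1]] u
      by (auto simp: L0_dist_self)
  qed
qed (auto simp: L0_topology_def)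

lemma limitin_L0_topology:
  assumes \<phi>: "\<And>i. \<phi> i \<in> L0 M" and u: "u \<in> L0 M"
  shows "limitin (L0_topology M) \<phi> u F \<longleftrightarrow>
    (\<forall>U\<in>sets M. emeasure M U < \<infinity> \<longrightarrow> ((\<lambda>i. L0_dist M U (\<phi> i) u) \<longlongrightarrow> 0) F)"
proof safe
  fix U assume lim: "limitin (L0_topology M) \<phi> u F" and U: "U \<in> sets M" "emeasure M U < \<infinity>"
  show "((\<lambda>i. L0_dist M U (\<phi> i) u) \<longlongrightarrow> 0) F"
  proof (rule tendstoI)
    fix e :: real assume e: "0 < e"
    have "eventually (\<lambda>i. \<phi> i \<in> {v \<in> L0 M. L0_dist M U u v < e}) F"
      using lim openin_L0_topology_ball[OF u U e] u e unfolding limitin_def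
      by (auto simp: L0_dist_self)
    thus "\<forall>\<^sub>F i in F. dist (L0_dist M U (\<phi> i) u) 0 < e"
      by eventually_elim (auto simp: L0_dist_commute[of _ _ u] L0_dist_nonneg)
  qed
next
  assume lim: "\<forall>U\<in>sets M. emeasure M U < \<infinity> \<longrightarrow> ((\<lambda>i. L0_dist M U (\<phi> i) u) \<longlongrightarrow> 0) F"
  have "eventually (\<lambda>i. \<phi> i \<in> S) F" if "openin (L0_topology M) S" "u \<in> S" for S
    using that unfolding L0_topology_def openin_topology_generated_by_iff
  proof (induction rule: generate_topology_on.induct)
    case (Int a b)
    thus ?case by (auto intro: eventually_conj)
  next
    case (UN K)
    then obtain k where "k \<in> K" "u \<in> k" by blast
    with UN.IH[of k] show ?case by (auto elim!: eventually_mono)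
  next
    case (Basis s)
    then obtain w U e where s: "s = {v \<in> L0 M. L0_dist M U w v < e}"
      and w: "w \<in> L0 M" and U: "U \<in> sets M" "emeasure M U < \<infinity>" by blast
    have "L0_dist M U w u < e" using Basis.prems s by simp
    moreover have "((\<lambda>i. L0_dist M U (\<phi> i) u) \<longlongrightarrow> 0) F" using lim U by blast
    ultimately have "eventually (\<lambda>i. L0_dist M U (\<phi> i) u < e - L0_dist M U w u) F"
      by (intro order_tendstoD(2)) auto
    thus ?case
    proof eventually_elim
      case (elim i)
      thus ?case
        using L0_dist_triangle[OF w u \<phi> U, of i] by (auto simp: s \<phi> L0_dist_commute[of _ _ u])
    qed
  qed simp
  thus "limitin (L0_topology M) \<phi> u F"
    using u by (auto simp: limitin_def topspace_L0_topology)
qed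


section \<open>Quadratic forms\<close>

text \<open>In \<^typ>\<open>ennreal\<close> we have \<open>0 * \<infinity> = 0\<close>, as required for homogeneity.\<close>

definition quadratic_form :: "'a measure \<Rightarrow> (('a \<Rightarrow> real) set \<Rightarrow> ennreal) \<Rightarrow> bool" where
  "quadratic_form M q \<longleftrightarrow>
     (\<forall>u\<in>L0 M. \<forall>v\<in>L0 M. 2 * q u + 2 * q v = q (L0_add M u v) + q (L0_diff M u v)) \<and>
     (\<forall>u\<in>L0 M. \<forall>c. q (L0_scale M c u) = ennreal (\<bar>c\<bar>\<^sup>2) * q u)"

definition form_domain :: "'a measure \<Rightarrow> (('a \<Rightarrow> real) set \<Rightarrow> ennreal) \<Rightarrow> ('a \<Rightarrow> real) set set" where
  "form_domain M q = {u \<in> L0 M. q u < \<infinity>}"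

definition form_kernel :: "'a measure \<Rightarrow> (('a \<Rightarrow> real) set \<Rightarrow> ennreal) \<Rightarrow> ('a \<Rightarrow> real) set set" where
  "form_kernel M q = {u \<in> L0 M. q u = 0}"

text \<open>The seminorm and the bilinear form are only meaningful on \<open>form_domain M q\<close>.\<close>

definition form_norm :: "(('a \<Rightarrow> real) set \<Rightarrow> ennreal) \<Rightarrow> ('a \<Rightarrow> real) set \<Rightarrow> real" where
  "form_norm q u = sqrt (enn2real (q u))"

definition form_inner ::
    "'a measure \<Rightarrow> (('a \<Rightarrow> real) set \<Rightarrow> ennreal) \<Rightarrow> ('a \<Rightarrow> real) set \<Rightarrow> ('a \<Rightarrow> real) set \<Rightarrow> real" where
  "form_inner M q u v = (enn2real (q (L0_add M u v)) - enn2real (q (L0_diff M u v))) / 4"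

definition seminorm_topology ::
    "'a measure \<Rightarrow> (('a \<Rightarrow> real) set \<Rightarrow> ennreal) \<Rightarrow> ('a \<Rightarrow> real) set topology" where
  "seminorm_topology M q = topology_generated_by
     {{v \<in> form_domain M q. form_norm q (L0_diff M v u) < e} | u e. u \<in> form_domain M q \<and> 0 < e}"

definition form_topology ::
    "'a measure \<Rightarrow> (('a \<Rightarrow> real) set \<Rightarrow> ennreal) \<Rightarrow> ('a \<Rightarrow> real) set topology" where
  "form_topology M q = topology_generated_by
     ({S. openin (subtopology (L0_topology M) (form_domain M q)) S} \<union>
      {S. openin (seminorm_topology M q) S})"

text \<open>
  Completeness is that of the topological vector space \<open>form_domain M q\<close>, which need not be
  metrizable; it is therefore stated with Cauchy filters for the uniformity whose entourages are
  \<open>{(u, v). u - v \<in> V}\<close>, with \<open>V\<close> a neighbourhood of zero.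
\<close>

definition form_Cauchy ::
    "'a measure \<Rightarrow> (('a \<Rightarrow> real) set \<Rightarrow> ennreal) \<Rightarrow> ('a \<Rightarrow> real) set filter \<Rightarrow> bool" where
  "form_Cauchy M q F \<longleftrightarrow>
     F \<noteq> bot \<and> eventually (\<lambda>u. u \<in> form_domain M q) F \<and>
     (\<forall>V. openin (form_topology M q) V \<and> L0_zero M \<in> V \<longrightarrow>
        eventually (\<lambda>(u, v). L0_diff M u v \<in> V) (F \<times>\<^sub>F F))"

definition closed_form :: "'a measure \<Rightarrow> (('a \<Rightarrow> real) set \<Rightarrow> ennreal) \<Rightarrow> bool" where
  "closed_form M q \<longleftrightarrow>
     (\<forall>F. form_Cauchy M q F \<longrightarrow> (\<exists>u\<in>form_domain M q. limitin (form_topology M q) (\<lambda>v. v) u F))"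


section \<open>Energy forms\<close>

definition cutoff :: "real \<Rightarrow> (real \<Rightarrow> real) \<Rightarrow> bool" where
  "cutoff \<epsilon> C \<longleftrightarrow>
     mono C \<and> range C \<subseteq> {-\<epsilon>..1 + \<epsilon>} \<and> (\<forall>x y. \<bar>C x - C y\<bar> \<le> \<bar>x - y\<bar>) \<and> (\<forall>x\<in>{0..1}. C x = x)"

definition Markovian :: "'a measure \<Rightarrow> (('a \<Rightarrow> real) set \<Rightarrow> ennreal) \<Rightarrow> bool" where
  "Markovian M E \<longleftrightarrow> (\<forall>\<epsilon>>0. \<exists>C. cutoff \<epsilon> C \<and> (\<forall>u\<in>L0 M. E (L0_comp M C u) \<le> E u))"

definition energy_form :: "'a measure \<Rightarrow> (('a \<Rightarrow> real) set \<Rightarrow> ennreal) \<Rightarrow> bool" where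
  "energy_form M E \<longleftrightarrow> quadratic_form M E \<and> closed_form M E \<and> Markovian M E"

definition transient :: "'a measure \<Rightarrow> (('a \<Rightarrow> real) set \<Rightarrow> ennreal) \<Rightarrow> bool" where
  "transient M E \<longleftrightarrow> form_kernel M E = {L0_zero M}"


section \<open>Real Hilbert spaces on a carrier set\<close>

locale real_inner_product_space_on =
  fixes V :: "'v set"
    and add :: "'v \<Rightarrow> 'v \<Rightarrow> 'v"
    and smul :: "real \<Rightarrow> 'v \<Rightarrow> 'v"
    and zero :: 'v
    and ip :: "'v \<Rightarrow> 'v \<Rightarrow> real"
  assumes zero_mem: "zero \<in> V"
    and add_mem: "u \<in> V \<Longrightarrow> v \<in> V \<Longrightarrow> add u v \<in> V"
    and smul_mem: "u \<in> V \<Longrightarrow> smul c u \<in> V"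
    and add_assoc: "u \<in> V \<Longrightarrow> v \<in> V \<Longrightarrow> w \<in> V \<Longrightarrow> add (add u v) w = add u (add v w)"
    and add_commute: "u \<in> V \<Longrightarrow> v \<in> V \<Longrightarrow> add u v = add v u"
    and add_zero: "u \<in> V \<Longrightarrow> add u zero = u"
    and add_uminus: "u \<in> V \<Longrightarrow> add u (smul (- 1) u) = zero"
    and smul_add_right: "u \<in> V \<Longrightarrow> v \<in> V \<Longrightarrow> smul c (add u v) = add (smul c u) (smul c v)"
    and smul_add_left: "u \<in> V \<Longrightarrow> smul (c + d) u = add (smul c u) (smul d u)"
    and smul_smul: "u \<in> V \<Longrightarrow> smul c (smul d u) = smul (c * d) u"
    and smul_one: "u \<in> V \<Longrightarrow> smul 1 u = u"
    and ip_commute: "u \<in> V \<Longrightarrow> v \<in> V \<Longrightarrow> ip u v = ip v u"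
    and ip_add_left: "u \<in> V \<Longrightarrow> v \<in> V \<Longrightarrow> w \<in> V \<Longrightarrow> ip (add u v) w = ip u w + ip v w"
    and ip_smul_left: "u \<in> V \<Longrightarrow> v \<in> V \<Longrightarrow> ip (smul c u) v = c * ip u v"
    and ip_nonneg: "u \<in> V \<Longrightarrow> 0 \<le> ip u u"
    and ip_eq_zero_iff: "u \<in> V \<Longrightarrow> ip u u = 0 \<longleftrightarrow> u = zero"

text \<open>
  The locale \<open>Metric_space\<close> asks for nonnegativity and symmetry also off the carrier, so the
  distance is set to zero there.
\<close>

definition ip_dist ::
    "'v set \<Rightarrow> ('v \<Rightarrow> 'v \<Rightarrow> 'v) \<Rightarrow> (real \<Rightarrow> 'v \<Rightarrow> 'v) \<Rightarrow> ('v \<Rightarrow> 'v \<Rightarrow> real) \<Rightarrow> 'v \<Rightarrow> 'v \<Rightarrow> real" where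
  "ip_dist V add smul ip u v =
     (if u \<in> V \<and> v \<in> V
      then sqrt (ip (add u (smul (- 1) v)) (add u (smul (- 1) v))) else 0)"

context real_inner_product_space_on
begin

lemma ip_add_right: "u \<in> V \<Longrightarrow> v \<in> V \<Longrightarrow> w \<in> V \<Longrightarrow> ip w (add u v) = ip w u + ip w v"
  by (metis ip_commute ip_add_left add_mem)

lemma ip_smul_right: "u \<in> V \<Longrightarrow> v \<in> V \<Longrightarrow> ip u (smul c v) = c * ip u v"
  by (metis ip_commute ip_smul_left smul_mem)

lemma ip_cauchy_schwarz:
  assumes u: "u \<in> V" and v: "v \<in> V"
  shows "(ip u v)\<^sup>2 \<le> ip u u * ip v v"
proof (cases "ip v v = 0")
  case True
  hence "v = add v v"
    using ip_eq_zero_iff[OF v] add_zero v by metis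
  hence "ip u v = 0"
    using ip_add_right[OF v v u] by simp
  thus ?thesis by (simp add: True)
next
  case False
  hence pos: "0 < ip v v" using ip_nonneg[OF v] by simp
  let ?c = "- (ip u v / ip v v)"
  have "0 \<le> ip (add u (smul ?c v)) (add u (smul ?c v))"
    by (intro ip_nonneg add_mem smul_mem u v)
  also have "\<dots> = ip u u + 2 * ?c * ip u v + ?c * ?c * ip v v"
    using u v
    by (simp only: ip_add_left ip_add_right ip_smul_left ip_smul_right add_mem smul_mem
        ip_commute[OF v u]) (simp only: algebra_simps)
  also have "\<dots> = ip u u - (ip u v)\<^sup>2 / ip v v"
    using pos by (simp add: field_simps power2_eq_square)
  finally show ?thesis using pos by (simp add: field_simps)
qed

lemma Metric_space_ip_dist: "Metric_space V (ip_dist V add smul ip)"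
proof
  note mem = add_mem smul_mem
  note ip = ip_add_left ip_add_right ip_smul_left ip_smul_right mem
  let ?d = "\<lambda>u v. add u (smul (- 1) v)"
  fix x y
  show "0 \<le> ip_dist V add smul ip x y"
    by (simp add: ip_dist_def ip_nonneg mem)
  show "ip_dist V add smul ip x y = ip_dist V add smul ip y x"
    by (auto simp: ip_dist_def ip)
  show "ip_dist V add smul ip x y = 0 \<longleftrightarrow> x = y" if x: "x \<in> V" and y: "y \<in> V"
  proof -
    have "x = y" if "?d x y = zero"
    proof -
      have "y = add (?d x y) y"
        using that y add_zero add_commute zero_mem by metis
      also have "\<dots> = add x (?d y y)"
        using x y add_assoc add_commute mem by metis
      also have "\<dots> = x" using x y add_uminus add_zero by simp
      finally show ?thesis ..
    qed
    thus ?thesis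
      using x y by (auto simp: ip_dist_def ip_eq_zero_iff mem add_uminus)
  qed
  fix z assume x: "x \<in> V" and y: "y \<in> V" and z: "z \<in> V"
  let ?a = "?d x y" and ?b = "?d y z"
  have V: "?a \<in> V" "?b \<in> V" "?d x z \<in> V" using x y z mem by auto
  have "ip (?d x z) (?d x z) = ip ?a ?a + 2 * ip ?a ?b + ip ?b ?b"
    using x y z by (simp add: ip ip_commute algebra_simps)
  also have "\<dots> \<le> (sqrt (ip ?a ?a) + sqrt (ip ?b ?b))\<^sup>2"
  proof -
    have "ip ?a ?b \<le> sqrt (ip ?a ?a * ip ?b ?b)"
      using ip_cauchy_schwarz[OF V(1,2)] by (rule real_le_rsqrt)
    thus ?thesis
      using V by (simp add: power2_sum ip_nonneg real_sqrt_mult)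
  qed
  finally have "sqrt (ip (?d x z) (?d x z)) \<le> sqrt (ip ?a ?a) + sqrt (ip ?b ?b)"
    using V by (intro real_le_lsqrt) (auto simp: ip_nonneg)
  thus "ip_dist V add smul ip x z \<le> ip_dist V add smul ip x y + ip_dist V add smul ip y z"
    using x y z by (simp add: ip_dist_def)
qed

end

locale real_Hilbert_space_on = real_inner_product_space_on +
  assumes complete: "Metric_space.mcomplete V (ip_dist V add smul ip)"

end

theory Submission
  imports Defs
begin

text \<open>
  The hard implication is that transience makes the embedding continuous.  Closedness gives lower
  semicontinuity of the form under a.e. limits, and the Markov property then gives
  \<open>E (max 0 (min 1 f)) \<le> E f\<close>.  If small energy did not force smallness in measure on some set \<open>U\<close> of
  finite measure, there would be functions \<open>p n\<close> with values in \<open>[0, 1]\<close>, summable energy norms and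
  integrals over \<open>U\<close> bounded below.  The truncated tail sums \<open>min 1 (\<Sum>n\<ge>N. p n)\<close> then decrease
  to a function of zero energy that does not vanish on \<open>U\<close>.  Conversely, continuity of the embedding
  makes the form topology agree with the topology of the seminorm, so closedness becomes Hilbert
  space completeness, and a Hilbert space has trivial kernel.
\<close>

section \<open>The bilinear form of a quadratic form\<close>

locale L0_quadratic_form =
  fixes M :: "'a measure" and E :: "('a \<Rightarrow> real) set \<Rightarrow> ennreal"
  assumes quadratic: "quadratic_form M E"
begin

text \<open>Passing to representatives turns vector space identities between classes into pointwise
  identities of functions.\<close>

definition q :: "('a \<Rightarrow> real) \<Rightarrow> ennreal" where
  "q f = E (L0_class M f)"

definition fdom :: "('a \<Rightarrow> real) set" where
  "fdom = {f \<in> borel_measurable M. q f < \<infinity>}"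

text \<open>On functions of infinite energy \<open>e\<close> has the junk value \<open>0\<close>.\<close>

definition e :: "('a \<Rightarrow> real) \<Rightarrow> real" where
  "e f = enn2real (q f)"

definition B :: "('a \<Rightarrow> real) \<Rightarrow> ('a \<Rightarrow> real) \<Rightarrow> real" where
  "B f g = (e (\<lambda>x. f x + g x) - e (\<lambda>x. f x - g x)) / 4"

lemma q_parallelogram:
  assumes "f \<in> borel_measurable M" "g \<in> borel_measurable M"
  shows "2 * q f + 2 * q g = q (\<lambda>x. f x + g x) + q (\<lambda>x. f x - g x)"
  using quadratic L0_class_in_L0[OF assms(1)] L0_class_in_L0[OF assms(2)]
  unfolding quadratic_form_def q_def
  by (metis L0_add_class[OF assms] L0_diff_class[OF assms])

lemma q_scale:
  assumes "f \<in> borel_measurable M"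
  shows "q (\<lambda>x. c * f x) = ennreal (c\<^sup>2) * q f"
proof -
  have "E (L0_scale M c (L0_class M f)) = ennreal (\<bar>c\<bar>\<^sup>2) * E (L0_class M f)"
    using quadratic L0_class_in_L0[OF assms] unfolding quadratic_form_def by blast
  thus ?thesis by (simp add: q_def L0_scale_class[OF assms assms])
qed

lemma q_cong_AE:
  assumes "f \<in> borel_measurable M" "g \<in> borel_measurable M" "AE x in M. f x = g x"
  shows "q f = q g"
  unfolding q_def using L0_class_eqI[OF assms] by simp

lemma q_add_le:
  assumes "f \<in> borel_measurable M" "g \<in> borel_measurable M"
  shows "q (\<lambda>x. f x + g x) \<le> 2 * q f + 2 * q g"
  unfolding q_parallelogram[OF assms] by simp

lemma fdom_measurable: "f \<in> fdom \<Longrightarrow> f \<in> borel_measurable M"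
  by (simp add: fdom_def)

text \<open>Scaling by 0 gives the value before finiteness is known: the right side is
  \<open>0 * q (\<lambda>x. 0)\<close>, which is 0 even if the second factor were infinite.\<close>

lemma fdom_zero: "(\<lambda>x. 0) \<in> fdom"
  using q_scale[of "\<lambda>x. 0" 0] by (simp add: fdom_def)

lemma e_zero: "e (\<lambda>x. 0) = 0"
  using q_scale[of "\<lambda>x. 0" 0] by (simp add: e_def)

lemma fdom_scale:
  assumes "f \<in> fdom"
  shows "(\<lambda>x. c * f x) \<in> fdom"
  using assms q_scale[of f c] by (auto simp: fdom_def ennreal_mult_less_top)

lemma fdom_add:
  assumes "f \<in> fdom" "g \<in> fdom"
  shows "(\<lambda>x. f x + g x) \<in> fdom"
proof -
  have "q (\<lambda>x. f x + g x) \<le> 2 * q f + 2 * q g"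
    using assms by (intro q_add_le) (auto simp: fdom_def)
  also have "\<dots> < \<infinity>" using assms by (simp add: fdom_def ennreal_mult_less_top)
  finally show ?thesis using assms by (auto simp: fdom_def)
qed

lemma fdom_diff:
  assumes "f \<in> fdom" "g \<in> fdom"
  shows "(\<lambda>x. f x - g x) \<in> fdom"
  using fdom_add[OF assms(1) fdom_scale[OF assms(2), of "-1"]] by simp

lemmas fdom_closed = fdom_zero fdom_scale fdom_add fdom_diff

lemma e_nonneg: "0 \<le> e f"
  by (simp add: e_def)

lemma ennreal_e: "f \<in> fdom \<Longrightarrow> ennreal (e f) = q f"
  by (simp add: e_def fdom_def)

lemma e_parallelogram:
  assumes "f \<in> fdom" "g \<in> fdom"
  shows "2 * e f + 2 * e g = e (\<lambda>x. f x + g x) + e (\<lambda>x. f x - g x)"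
proof -
  have "ennreal (2 * e f + 2 * e g) = 2 * q f + 2 * q g"
    using assms by (simp add: ennreal_mult e_nonneg ennreal_e)
  also have "\<dots> = ennreal (e (\<lambda>x. f x + g x) + e (\<lambda>x. f x - g x))"
    using assms by (simp add: q_parallelogram fdom_measurable e_nonneg ennreal_e fdom_closed)
  finally show ?thesis
    by (subst (asm) ennreal_inj) (auto simp: e_nonneg)
qed

lemma e_scale:
  assumes "f \<in> fdom"
  shows "e (\<lambda>x. c * f x) = c\<^sup>2 * e f"
  using assms by (simp add: e_def q_scale fdom_measurable enn2real_mult)

lemma e_minus: "f \<in> fdom \<Longrightarrow> e (\<lambda>x. - f x) = e f"
  using e_scale[of f "-1"] by simp

lemma e_diff_commute: "f \<in> fdom \<Longrightarrow> g \<in> fdom \<Longrightarrow> e (\<lambda>x. f x - g x) = e (\<lambda>x. g x - f x)"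
  using e_minus[OF fdom_diff, of f g] by simp

section \<open>Polarization and additivity\<close>

lemma B_commute: "f \<in> fdom \<Longrightarrow> g \<in> fdom \<Longrightarrow> B f g = B g f"
  unfolding B_def using e_diff_commute[of f g] by (simp add: add.commute)

lemma B_self:
  assumes "f \<in> fdom"
  shows "B f f = e f"
proof -
  have "(\<lambda>x. f x + f x) = (\<lambda>x. 2 * f x)" by auto
  thus ?thesis using e_scale[OF assms, of 2] by (simp add: B_def e_zero)
qed

lemma B_zero: "g \<in> fdom \<Longrightarrow> B (\<lambda>x. 0) g = 0"
  by (simp add: B_def e_minus)

text \<open>Jordan-von Neumann argument: the parallelogram laws for the pairs \<open>f + h\<close>,
  \<open>g\<close> and \<open>f - h\<close>, \<open>g\<close> are subtracted, and \<open>e g\<close>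
  cancels.\<close>

lemma B_add_diff:
  assumes "f \<in> fdom" "g \<in> fdom" "h \<in> fdom"
  shows "B (\<lambda>x. f x + g x) h + B (\<lambda>x. f x - g x) h = 2 * B f h"
proof -
  have "2 * e (\<lambda>x. f x + h x) + 2 * e g
      = e (\<lambda>x. f x + g x + h x) + e (\<lambda>x. f x - g x + h x)"
    using e_parallelogram[of "\<lambda>x. f x + h x" g] assms by (simp add: fdom_closed algebra_simps)
  moreover have "2 * e (\<lambda>x. f x - h x) + 2 * e g
      = e (\<lambda>x. f x + g x - h x) + e (\<lambda>x. f x - g x - h x)"
    using e_parallelogram[of "\<lambda>x. f x - h x" g] assms by (simp add: fdom_closed algebra_simps)
  ultimately show ?thesis by (simp add: B_def field_simps)
qed

text \<open>\<open>B_add_diff\<close> is applied to the half-sum \<open>u\<close> with the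
  half-difference \<open>v\<close>, and to \<open>u\<close> with itself; both results equal
  \<open>2 * B u h\<close>.\<close>

lemma B_add_left:
  assumes "f \<in> fdom" "g \<in> fdom" "h \<in> fdom"
  shows "B (\<lambda>x. f x + g x) h = B f h + B g h"
proof -
  define u where "u = (\<lambda>x. (f x + g x) / 2)"
  define v where "v = (\<lambda>x. (f x - g x) / 2)"
  have uv: "u \<in> fdom" "v \<in> fdom"
    using fdom_scale[OF fdom_add[OF assms(1,2)], of "1/2"] fdom_scale[OF fdom_diff[OF assms(1,2)], of "1/2"]
    by (simp_all add: u_def v_def)
  have sum: "(\<lambda>x. u x + u x) = (\<lambda>x. f x + g x)"
    by (auto simp: u_def)
  have split: "(\<lambda>x. u x + v x) = f" "(\<lambda>x. u x - v x) = g"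
    by (auto simp: u_def v_def field_simps)
  have "B f h + B g h = 2 * B u h"
    using B_add_diff[OF uv assms(3)] unfolding split .
  moreover have "B (\<lambda>x. f x + g x) h = 2 * B u h"
    using B_add_diff[OF uv(1,1) assms(3)] unfolding sum by (simp add: B_zero assms(3))
  ultimately show ?thesis by simp
qed

end

text \<open>The defect \<open>\<phi> t - t * \<phi> 1\<close> is additive and 1-periodic, hence globally bounded, hence zero.\<close>

lemma additive_bounded_imp_linear:
  fixes \<phi> :: "real \<Rightarrow> real"
  assumes add: "\<And>s t. \<phi> (s + t) = \<phi> s + \<phi> t"
    and bound: "\<And>t. \<bar>t\<bar> \<le> 1 \<Longrightarrow> \<bar>\<phi> t\<bar> \<le> K"
  shows "\<phi> t = t * \<phi> 1"
proof -
  define \<psi> where "\<psi> t = \<phi> t - t * \<phi> 1" for t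
  have \<psi>_add: "\<psi> (s + t) = \<psi> s + \<psi> t" for s t
    by (simp add: \<psi>_def add algebra_simps)
  have \<psi>_0: "\<psi> 0 = 0" using \<psi>_add[of 0 0] by simp
  have \<psi>_nat: "\<psi> (real n * t) = real n * \<psi> t" for n t
    by (induction n) (simp_all add: \<psi>_0 \<psi>_add algebra_simps)
  have \<psi>_minus: "\<psi> (- t) = - \<psi> t" for t
    using \<psi>_add[of t "- t"] \<psi>_0 by simp
  have \<psi>_int: "\<psi> (of_int k) = 0" for k
  proof -
    have "\<psi> (real n) = 0" for n using \<psi>_nat[of n 1] by (simp add: \<psi>_def)
    thus ?thesis by (cases k) (simp_all add: \<psi>_minus del: of_nat_Suc)
  qed
  have \<psi>_bound: "\<bar>\<psi> t\<bar> \<le> 2 * K" for t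
  proof -
    have f: "\<bar>frac t\<bar> \<le> 1" using frac_ge_0[of t] frac_lt_1[of t] by simp
    have "\<psi> t = \<psi> (frac t)"
      using \<psi>_add[of "of_int \<lfloor>t\<rfloor>" "frac t"] \<psi>_int by (simp add: frac_def)
    also have "\<bar>\<dots>\<bar> \<le> \<bar>\<phi> (frac t)\<bar> + \<bar>frac t\<bar> * \<bar>\<phi> 1\<bar>"
      unfolding \<psi>_def using abs_triangle_ineq4[of "\<phi> (frac t)" "frac t * \<phi> 1"] by (simp add: abs_mult)
    also have "\<dots> \<le> K + 1 * K"
      using bound[of 1] by (intro add_mono mult_mono bound f) auto
    finally show ?thesis by simp
  qed
  have "\<psi> t = 0"
  proof (rule ccontr)
    assume "\<psi> t \<noteq> 0"
    then obtain n where "2 * K < real n * \<bar>\<psi> t\<bar>"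
      using ex_less_of_nat_mult[of "\<bar>\<psi> t\<bar>" "2 * K"] by auto
    thus False using \<psi>_bound[of "real n * t"] by (simp add: \<psi>_nat abs_mult)
  qed
  thus ?thesis by (simp add: \<psi>_def)
qed

section \<open>Homogeneity, Cauchy-Schwarz and the triangle inequality\<close>

context L0_quadratic_form
begin

text \<open>The map \<open>t \<mapsto> B (t f) g\<close> is additive, and nonnegativity of
  \<open>e\<close> bounds it on \<open>\<bar>t\<bar> \<le> 1\<close>; the bound upgrades additivity
  to real linearity.\<close>

lemma B_scale_left:
  assumes "f \<in> fdom" "g \<in> fdom"
  shows "B (\<lambda>x. c * f x) g = c * B f g"
proof -
  \<comment> \<open>The factor 1 is kept so that the right side reads \<open>c * \<phi> 1\<close>
    with \<open>\<phi> t = B (\<lambda>x. t * f x) g\<close>.\<close>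
  have "B (\<lambda>x. c * f x) g = c * B (\<lambda>x. 1 * f x) g"
  proof (rule additive_bounded_imp_linear)
    show "B (\<lambda>x. (s + t) * f x) g = B (\<lambda>x. s * f x) g + B (\<lambda>x. t * f x) g" for s t
      using B_add_left[of "\<lambda>x. s * f x" "\<lambda>x. t * f x" g] assms by (simp add: fdom_closed algebra_simps)
    show "\<bar>B (\<lambda>x. t * f x) g\<bar> \<le> e f + e g" if "\<bar>t\<bar> \<le> 1" for t
    proof -
      have "\<bar>B (\<lambda>x. t * f x) g\<bar> \<le> (e (\<lambda>x. t * f x + g x) + e (\<lambda>x. t * f x - g x)) / 4"
        unfolding B_def using e_nonneg[of "\<lambda>x. t * f x + g x"] e_nonneg[of "\<lambda>x. t * f x - g x"]
        by (simp add: abs_le_iff)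
      also have "\<dots> = (t\<^sup>2 * e f + e g) / 2"
        using e_parallelogram[of "\<lambda>x. t * f x" g] assms by (simp add: fdom_closed e_scale field_simps)
      also have "\<dots> \<le> t\<^sup>2 * e f + e g"
        using e_nonneg by simp
      also have "\<dots> \<le> 1 * e f + e g"
        using that by (intro add_mono mult_right_mono e_nonneg order_refl) (simp add: abs_square_le_1)
      finally show ?thesis by simp
    qed
  qed
  thus ?thesis by simp
qed

lemma e_add:
  assumes "f \<in> fdom" "g \<in> fdom"
  shows "e (\<lambda>x. f x + g x) = e f + 2 * B f g + e g"
  using e_parallelogram[OF assms] by (simp add: B_def field_simps)

text \<open>The polynomial \<open>t \<mapsto> e (t f + g)\<close> is nonnegative; it is affine when
  \<open>e f = 0\<close>, which is why that case is separate.\<close>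

lemma B_cauchy_schwarz:
  assumes "f \<in> fdom" "g \<in> fdom"
  shows "(B f g)\<^sup>2 \<le> e f * e g"
proof -
  have ge: "0 \<le> e f * t\<^sup>2 + 2 * t * B f g + e g" for t
  proof -
    have "e (\<lambda>x. t * f x + g x) = t\<^sup>2 * e f + 2 * (t * B f g) + e g"
      using assms by (simp add: e_add fdom_closed e_scale B_scale_left)
    thus ?thesis using e_nonneg[of "\<lambda>x. t * f x + g x"] by (simp add: algebra_simps)
  qed
  show ?thesis
  proof (cases "e f = 0")
    case True
    have "B f g = 0"
    proof (rule ccontr)
      assume nz: "B f g \<noteq> 0"
      \<comment> \<open>This \<open>t\<close> is the point where the affine function would take the
        value -1.\<close>
      have "0 \<le> 2 * (- (e g + 1) / (2 * B f g)) * B f g + e g"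
        using ge[of "- (e g + 1) / (2 * B f g)"] True by simp
      also have "\<dots> = -1" using nz by (simp add: field_simps)
      finally show False by simp
    qed
    thus ?thesis by (simp add: e_nonneg)
  next
    case False
    hence "0 < e f" using e_nonneg[of f] by simp
    \<comment> \<open>The polynomial is evaluated at its minimizer.\<close>
    thus ?thesis using ge[of "- B f g / e f"] by (simp add: field_simps power2_eq_square)
  qed
qed

lemma e_triangle:
  assumes "f \<in> fdom" "g \<in> fdom"
  shows "sqrt (e (\<lambda>x. f x + g x)) \<le> sqrt (e f) + sqrt (e g)"
proof (rule real_le_lsqrt)
  have "B f g \<le> sqrt (e f * e g)"
    using B_cauchy_schwarz[OF assms] by (rule real_le_rsqrt)
  thus "e (\<lambda>x. f x + g x) \<le> (sqrt (e f) + sqrt (e g))\<^sup>2"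
    by (simp add: e_add assms power2_sum e_nonneg real_sqrt_mult)
qed (simp_all add: e_nonneg)

lemma e_diff_triangle:
  assumes "f \<in> fdom" "g \<in> fdom" "h \<in> fdom"
  shows "sqrt (e (\<lambda>x. f x - h x)) \<le> sqrt (e (\<lambda>x. f x - g x)) + sqrt (e (\<lambda>x. g x - h x))"
  using e_triangle[of "\<lambda>x. f x - g x" "\<lambda>x. g x - h x"] assms by (simp add: fdom_closed)

end

section \<open>The form topology\<close>

lemma ball_Collect_image2:
  "(\<forall>z\<in>{f x y | x y. P x y}. Q z) \<longleftrightarrow> (\<forall>x y. P x y \<longrightarrow> Q (f x y))"
  by blast

text \<open>Eventual membership passes to finite intersections and arbitrary unions, so only
  subbasic sets containing the limit matter.\<close>

lemma eventually_generate_topology: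
  assumes "generate_topology_on \<S> T" "u \<in> T"
    and "\<And>S. S \<in> \<S> \<Longrightarrow> u \<in> S \<Longrightarrow> eventually (\<lambda>i. \<phi> i \<in> S) F"
  shows "eventually (\<lambda>i. \<phi> i \<in> T) F"
  using assms(1,2)
proof (induction rule: generate_topology_on.induct)
  case (UN K)
  then obtain k where "k \<in> K" "u \<in> k" by blast
  with UN.IH[of k] show ?case by (auto elim!: eventually_mono)
qed (auto intro: eventually_conj assms(3))

lemma limitin_topology_generated_by:
  assumes "u \<in> topspace (topology_generated_by \<S>)"
  shows "limitin (topology_generated_by \<S>) \<phi> u F \<longleftrightarrow>
    (\<forall>S\<in>\<S>. u \<in> S \<longrightarrow> eventually (\<lambda>i. \<phi> i \<in> S) F)"
proof
  show "\<forall>S\<in>\<S>. u \<in> S \<longrightarrow> eventually (\<lambda>i. \<phi> i \<in> S) F"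
    if "limitin (topology_generated_by \<S>) \<phi> u F"
    using that by (auto simp: limitin_def topology_generated_by_Basis)
  show "limitin (topology_generated_by \<S>) \<phi> u F"
    if "\<forall>S\<in>\<S>. u \<in> S \<longrightarrow> eventually (\<lambda>i. \<phi> i \<in> S) F"
    using that assms
    by (auto simp: limitin_def openin_topology_generated_by_iff intro: eventually_generate_topology)
qed

lemma L0_diff_in_L0: "u \<in> L0 M \<Longrightarrow> v \<in> L0 M \<Longrightarrow> L0_diff M u v \<in> L0 M"
  unfolding L0_diff_def by (intro L0_class_in_L0 borel_measurable_diff L0_rep_measurable)

lemma L0_diff_zero:
  assumes "u \<in> L0 M"
  shows "L0_diff M u (L0_zero M) = u"
  using assms
  by (auto elim!: L0_cases simp: L0_zero_def L0_diff_class)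

text \<open>Translation invariance: closeness of \<open>u\<close> and \<open>v\<close> becomes
  closeness of their difference to zero, the form in which Cauchy filters are tested.\<close>

lemma L0_dist_diff_zero:
  assumes "u \<in> L0 M" "v \<in> L0 M" "U \<in> sets M"
  shows "L0_dist M U (L0_diff M u v) (L0_zero M) = L0_dist M U u v"
  using assms
  by (auto elim!: L0_cases simp: L0_zero_def L0_diff_class L0_dist_class)

lemma L0_zero_in_L0: "L0_zero M \<in> L0 M"
  by (simp add: L0_zero_def L0_class_in_L0)

section \<open>Convergence in the seminorm and form topologies\<close>

context L0_quadratic_form
begin

lemma form_domain_class: "f \<in> fdom \<Longrightarrow> L0_class M f \<in> form_domain M E"
  by (auto simp: form_domain_def fdom_def q_def L0_class_in_L0)

lemma form_domain_cases:
  assumes "u \<in> form_domain M E"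
  obtains f where "f \<in> fdom" "u = L0_class M f"
  using assms by (auto simp: form_domain_def fdom_def q_def elim!: L0_cases)

lemma form_domain_subset: "form_domain M E \<subseteq> L0 M"
  by (auto simp: form_domain_def)

lemma L0_diff_class_fdom:
  "f \<in> fdom \<Longrightarrow> g \<in> fdom \<Longrightarrow> L0_diff M (L0_class M f) (L0_class M g) = L0_class M (\<lambda>x. f x - g x)"
  by (intro L0_diff_class fdom_measurable)

lemma form_norm_class: "form_norm E (L0_class M f) = sqrt (e f)"
  by (simp add: form_norm_def e_def q_def)

lemma form_domain_diff:
  "u \<in> form_domain M E \<Longrightarrow> v \<in> form_domain M E \<Longrightarrow> L0_diff M u v \<in> form_domain M E"
  by (auto elim!: form_domain_cases simp: L0_diff_class_fdom intro!: form_domain_class fdom_diff)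

lemma form_domain_zero: "L0_zero M \<in> form_domain M E"
  unfolding L0_zero_def by (intro form_domain_class fdom_zero)

lemma form_norm_nonneg: "0 \<le> form_norm E u"
  by (simp add: form_norm_def)

lemma form_norm_diff_self: "u \<in> form_domain M E \<Longrightarrow> form_norm E (L0_diff M u u) = 0"
  by (auto elim!: form_domain_cases simp: L0_diff_class_fdom form_norm_class e_zero)

lemma form_norm_diff_triangle:
  assumes "u \<in> form_domain M E" "v \<in> form_domain M E" "w \<in> form_domain M E"
  shows "form_norm E (L0_diff M u w) \<le> form_norm E (L0_diff M u v) + form_norm E (L0_diff M v w)"
  using assms
  by (auto elim!: form_domain_cases simp: L0_diff_class_fdom form_norm_class e_diff_triangle)

lemma topspace_seminorm_topology: "topspace (seminorm_topology M E) = form_domain M E"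
proof
  show "form_domain M E \<subseteq> topspace (seminorm_topology M E)"
  proof
    fix u assume u: "u \<in> form_domain M E"
    have "openin (seminorm_topology M E) {v \<in> form_domain M E. form_norm E (L0_diff M v u) < 1}"
      unfolding seminorm_topology_def using u by (intro topology_generated_by_Basis) force
    from openin_subset[OF this] u show "u \<in> topspace (seminorm_topology M E)"
      by (auto simp: form_norm_diff_self)
  qed
qed (auto simp: seminorm_topology_def)

text \<open>Subbasic balls have arbitrary centres \<open>w\<close>; the triangle inequality fits a
  ball around the limit \<open>u\<close> into each of them that contains \<open>u\<close>.\<close>

lemma limitin_seminorm_topology:
  assumes \<phi>: "\<And>i. \<phi> i \<in> form_domain M E" and u: "u \<in> form_domain M E"
  shows "limitin (seminorm_topology M E) \<phi> u F \<longleftrightarrow>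
    ((\<lambda>i. form_norm E (L0_diff M (\<phi> i) u)) \<longlongrightarrow> 0) F" (is "?L \<longleftrightarrow> ?R")
proof -
  have "?L \<longleftrightarrow> (\<forall>w\<in>form_domain M E. \<forall>r>0. form_norm E (L0_diff M u w) < r \<longrightarrow>
      eventually (\<lambda>i. form_norm E (L0_diff M (\<phi> i) w) < r) F)"
  proof -
    have "?L \<longleftrightarrow> (\<forall>S\<in>{{v \<in> form_domain M E. form_norm E (L0_diff M v w) < r} | w r.
        w \<in> form_domain M E \<and> 0 < r}. u \<in> S \<longrightarrow> eventually (\<lambda>i. \<phi> i \<in> S) F)"
      unfolding seminorm_topology_def
      by (rule limitin_topology_generated_by[OF u[folded topspace_seminorm_topology,
            unfolded seminorm_topology_def]])
    thus ?thesis by (simp only: ball_Collect_image2) (auto simp: u \<phi>)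
  qed
  also have "\<dots> \<longleftrightarrow> ?R"
  proof
    assume R: ?R
    show "\<forall>w\<in>form_domain M E. \<forall>r>0. form_norm E (L0_diff M u w) < r \<longrightarrow>
      eventually (\<lambda>i. form_norm E (L0_diff M (\<phi> i) w) < r) F"
    proof safe
      fix w and r :: real
      assume w: "w \<in> form_domain M E" and r: "form_norm E (L0_diff M u w) < r"
      have "eventually (\<lambda>i. form_norm E (L0_diff M (\<phi> i) u) < r - form_norm E (L0_diff M u w)) F"
        using R r by (intro order_tendstoD(2)) auto
      thus "eventually (\<lambda>i. form_norm E (L0_diff M (\<phi> i) w) < r) F"
      proof eventually_elim
        case (elim i)
        thus ?case using form_norm_diff_triangle[OF \<phi>[of i] u w] by simp
      qed
    qed
  next
    assume "\<forall>w\<in>form_domain M E. \<forall>r>0. form_norm E (L0_diff M u w) < r \<longrightarrow>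
      eventually (\<lambda>i. form_norm E (L0_diff M (\<phi> i) w) < r) F"
    thus ?R
      using u by (intro tendstoI) (simp add: form_norm_diff_self form_norm_nonneg)
  qed
  finally show ?thesis .
qed

lemma topspace_form_topology: "topspace (form_topology M E) = form_domain M E"
proof
  have "openin (form_topology M E) (topspace (seminorm_topology M E))"
    unfolding form_topology_def by (intro topology_generated_by_Basis) auto
  thus "form_domain M E \<subseteq> topspace (form_topology M E)"
    by (metis openin_subset topspace_seminorm_topology)
  show "topspace (form_topology M E) \<subseteq> form_domain M E"
    by (auto simp: form_topology_def openin_subtopology
        simp flip: topspace_seminorm_topology dest: openin_subset[THEN subsetD])
qed

text \<open>The subbasis is the union of two families of open sets, so the convergence test splits
  into one for each.\<close>

lemma limitin_form_topology:
  assumes \<phi>: "\<And>i. \<phi> i \<in> form_domain M E" and u: "u \<in> form_domain M E"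
  shows "limitin (form_topology M E) \<phi> u F \<longleftrightarrow>
    limitin (L0_topology M) \<phi> u F \<and> limitin (seminorm_topology M E) \<phi> u F"
proof -
  have uL: "u \<in> L0 M" using u form_domain_subset by auto
  have "limitin (form_topology M E) \<phi> u F \<longleftrightarrow>
    (\<forall>S. openin (subtopology (L0_topology M) (form_domain M E)) S \<longrightarrow> u \<in> S \<longrightarrow>
        eventually (\<lambda>i. \<phi> i \<in> S) F) \<and>
    (\<forall>S. openin (seminorm_topology M E) S \<longrightarrow> u \<in> S \<longrightarrow> eventually (\<lambda>i. \<phi> i \<in> S) F)"
    unfolding form_topology_def
    using limitin_topology_generated_by[OF u[folded topspace_form_topology, unfolded form_topology_def]]
    by auto
  also have "\<dots> \<longleftrightarrow> limitin (L0_topology M) \<phi> u F \<and> limitin (seminorm_topology M E) \<phi> u F"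
  proof -
    have "limitin (L0_topology M) \<phi> u F \<longleftrightarrow>
      (\<forall>S. openin (subtopology (L0_topology M) (form_domain M E)) S \<longrightarrow> u \<in> S \<longrightarrow>
        eventually (\<lambda>i. \<phi> i \<in> S) F)"
    proof -
      \<comment> \<open>Relatively open sets are traces of open sets on the domain, which
        \<open>\<phi>\<close> never leaves.\<close>
      have "(\<forall>S. openin (subtopology (L0_topology M) (form_domain M E)) S \<longrightarrow> u \<in> S \<longrightarrow>
          eventually (\<lambda>i. \<phi> i \<in> S) F) \<longleftrightarrow>
        (\<forall>T. openin (L0_topology M) T \<longrightarrow> u \<in> T \<inter> form_domain M E \<longrightarrow>
          eventually (\<lambda>i. \<phi> i \<in> T \<inter> form_domain M E) F)"
        unfolding openin_subtopology by blast
      thus ?thesis using u uL \<phi> by (auto simp: limitin_def topspace_L0_topology)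
    qed
    moreover have "limitin (seminorm_topology M E) \<phi> u F \<longleftrightarrow>
      (\<forall>S. openin (seminorm_topology M E) S \<longrightarrow> u \<in> S \<longrightarrow> eventually (\<lambda>i. \<phi> i \<in> S) F)"
      using u by (auto simp: limitin_def topspace_seminorm_topology)
    ultimately show ?thesis by simp
  qed
  finally show ?thesis .
qed

text \<open>Turns filter completeness into a statement on sequences. The Cauchy conditions are
  limits of double sequences, so that they can be read as convergence of differences to
  zero.\<close>

lemma closed_form_sequence:
  assumes closed: "closed_form M E" and g: "\<And>n. g n \<in> form_domain M E"
    and norm: "((\<lambda>(n, m). form_norm E (L0_diff M (g n) (g m))) \<longlongrightarrow> 0) (sequentially \<times>\<^sub>F sequentially)"
    and dist: "\<And>U. U \<in> sets M \<Longrightarrow> emeasure M U < \<infinity> \<Longrightarrow>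
      ((\<lambda>(n, m). L0_dist M U (g n) (g m)) \<longlongrightarrow> 0) (sequentially \<times>\<^sub>F sequentially)"
  obtains u where "u \<in> form_domain M E" "(\<lambda>n. form_norm E (L0_diff M (g n) u)) \<longlonglongrightarrow> 0"
    "\<And>U. U \<in> sets M \<Longrightarrow> emeasure M U < \<infinity> \<Longrightarrow> (\<lambda>n. L0_dist M U (g n) u) \<longlonglongrightarrow> 0"
proof -
  let ?S = "sequentially \<times>\<^sub>F sequentially"
  let ?F = "filtermap g sequentially"
  define \<delta> where "\<delta> p = L0_diff M (g (fst p)) (g (snd p))" for p
  have \<delta>: "\<delta> p \<in> form_domain M E" for p
    by (simp add: \<delta>_def form_domain_diff g)
  note gL = subsetD[OF form_domain_subset g] and \<delta>L = subsetD[OF form_domain_subset \<delta>]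
  have "limitin (form_topology M E) \<delta> (L0_zero M) ?S"
    unfolding limitin_form_topology[OF \<delta> form_domain_zero] limitin_L0_topology[OF \<delta>L L0_zero_in_L0]
      limitin_seminorm_topology[OF \<delta> form_domain_zero]
    using norm dist by (auto simp: L0_diff_zero \<delta>L L0_dist_diff_zero gL \<delta>_def case_prod_unfold
      L0_diff_in_L0)
  \<comment> \<open>The square of the image filter is the image of \<open>?S\<close> under pairs, so
    the Cauchy condition is the convergence of \<open>\<delta>\<close> to zero.\<close>
  hence "form_Cauchy M E ?F"
    unfolding form_Cauchy_def
    by (auto simp: filtermap_bot_iff eventually_filtermap g prod_filtermap1 prod_filtermap2
        limitin_def \<delta>_def case_prod_unfold)
  then obtain u where u: "u \<in> form_domain M E" and "limitin (form_topology M E) (\<lambda>v. v) u ?F"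
    using closed unfolding closed_form_def by blast
  hence lim: "limitin (form_topology M E) g u sequentially"
    by (simp add: limitin_def eventually_filtermap)
  have uL: "u \<in> L0 M" using u form_domain_subset by auto
  show ?thesis
    using lim that[OF u]
    unfolding limitin_form_topology[OF g u] limitin_L0_topology[OF gL uL]
      limitin_seminorm_topology[OF g u] by blast
qed

end

section \<open>Lower semicontinuity of closed forms\<close>

lemma L0_class_eq_AE:
  assumes "f \<in> borel_measurable M" "g \<in> borel_measurable M" "L0_class M f = L0_class M g"
  shows "AE x in M. f x = g x"
  using L0_rep_class(2)[OF assms(1)] L0_rep_class(2)[OF assms(2)]
  unfolding assms(3) by eventually_elim simp

lemma set_integrable_finite_bounded:
  fixes f :: "'a \<Rightarrow> real"
  assumes "f \<in> borel_measurable M" "\<And>x. \<bar>f x\<bar> \<le> 1" "U \<in> sets M" "emeasure M U < \<infinity>"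
  shows "set_integrable M U f"
  unfolding set_integrable_def
proof (rule Bochner_Integration.integrable_bound)
  show "integrable M (indicat_real U)"
    using assms by (intro integrable_real_indicator) auto
  show "(\<lambda>x. indicat_real U x *\<^sub>R f x) \<in> borel_measurable M"
    using assms by measurable
qed (use assms in \<open>auto simp: indicator_def\<close>)

text \<open>Hausdorff property of local convergence in measure. The set \<open>A\<close> where the
  functions differ has no subset of finite positive measure; by semi-finiteness it cannot have
  infinite measure either, so it is null.\<close>

lemma L0_eq_of_L0_dist:
  assumes sf: "semi_finite M" and f: "f \<in> borel_measurable M" and g: "g \<in> borel_measurable M"
    and dist: "\<And>U. U \<in> sets M \<Longrightarrow> emeasure M U < \<infinity> \<Longrightarrow> L0_dist M U (L0_class M f) (L0_class M g) = 0"
  shows "AE x in M. f x = g x"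
proof -
  note [measurable] = f g
  define A where "A = {x \<in> space M. f x \<noteq> g x}"
  have A: "A \<in> sets M" unfolding A_def by measurable
  have null: "emeasure M U = 0" if U: "U \<subseteq> A" "U \<in> sets M" "emeasure M U < \<infinity>" for U
  proof -
    have int: "set_integrable M U (\<lambda>x. min \<bar>f x - g x\<bar> 1)"
      by (rule set_integrable_finite_bounded[OF _ _ U(2,3)]) auto
    have "(LINT x:U|M. min \<bar>f x - g x\<bar> 1) = 0"
      using dist[OF U(2,3)] by (simp add: L0_dist_class U(2))
    hence "AE x in M. indicator U x * min \<bar>f x - g x\<bar> 1 = 0"
      using int integral_nonneg_eq_0_iff_AE[of M "\<lambda>x. indicator U x * min \<bar>f x - g x\<bar> 1"]
      by (simp add: set_lebesgue_integral_def set_integrable_def)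
    hence "AE x in M. x \<notin> U"
      using U(1) by (auto simp: A_def indicator_def split: if_splits elim!: eventually_mono)
    thus ?thesis using U(2) by (simp add: AE_iff_measurable[OF _ refl] AE_iff_null_sets null_setsD1)
  qed
  have "emeasure M A = 0"
  proof (cases "emeasure M A = \<infinity>")
    case True
    then obtain U where "U \<in> sets M" "U \<subseteq> A" "0 < emeasure M U" "emeasure M U < \<infinity>"
      using sf A unfolding semi_finite_def by blast
    thus ?thesis using null[of U] by simp
  next
    case False
    thus ?thesis using null[of A] A by (simp add: less_top)
  qed
  thus ?thesis using A unfolding A_def by (subst AE_iff_measurable[OF _ refl]) auto
qed

text \<open>Dominated convergence with the majorant \<open>indicat_real U\<close>.\<close>

lemma L0_dist_tendsto_AE:
  assumes f: "\<And>n. f n \<in> borel_measurable M" and g: "g \<in> borel_measurable M"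
    and lim: "AE x in M. (\<lambda>n. f n x) \<longlonglongrightarrow> g x" and U: "U \<in> sets M" "emeasure M U < \<infinity>"
  shows "(\<lambda>n. L0_dist M U (L0_class M (f n)) (L0_class M g)) \<longlonglongrightarrow> 0"
proof -
  note [measurable] = f g U(1)
  have "(\<lambda>n. \<integral>x. indicator U x * min \<bar>f n x - g x\<bar> 1 \<partial>M) \<longlonglongrightarrow> (\<integral>x. 0 \<partial>M)"
  proof (rule integral_dominated_convergence)
    show "integrable M (indicat_real U)"
      using U by (intro integrable_real_indicator) auto
    show "AE x in M. (\<lambda>n. indicat_real U x * min \<bar>f n x - g x\<bar> 1) \<longlonglongrightarrow> 0"
      using lim
    proof eventually_elim
      case (elim x)
      have "(\<lambda>n. indicat_real U x * min \<bar>f n x - g x\<bar> 1) \<longlonglongrightarrow> indicat_real U x * min \<bar>g x - g x\<bar> 1"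
        by (intro tendsto_intros elim)
      thus ?case by simp
    qed
  qed (auto simp: indicator_def)
  thus ?thesis by (simp add: L0_dist_class f g U set_lebesgue_integral_def)
qed

section \<open>Lower semicontinuity along almost everywhere limits\<close>

locale closed_L0_form = L0_quadratic_form +
  assumes semi_finite: "semi_finite M" and closed: "closed_form M E"
begin

text \<open>
  Near-minimizers \<open>g n\<close> of \<open>e\<close> on the decreasing convex sets \<open>C n\<close> containing the tails of \<open>f\<close> are
  \<open>e\<close>-Cauchy by the parallelogram identity.  Membership in \<open>C n\<close> is a pointwise condition, so the
  \<open>g n\<close> still converge to \<open>l\<close>, and closedness applies to them.
\<close>

lemma q_le_of_AE_limit:
  assumes f: "\<And>n. f n \<in> borel_measurable M" and l: "l \<in> borel_measurable M"
    and lim: "AE x in M. (\<lambda>n. f n x) \<longlonglongrightarrow> l x"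
    and c: "0 \<le> c" "\<And>n. q (f n) \<le> ennreal c"
  shows "q l \<le> ennreal c"
proof -
  \<comment> \<open>The last condition puts \<open>g x\<close> between the infimum and supremum of
    the tail of \<open>f k x\<close> if that tail is bounded, and says nothing otherwise.\<close>
  define C where "C n = {g \<in> borel_measurable M. q g \<le> ennreal c \<and>
    (\<forall>x a b. (\<forall>k\<ge>n. a \<le> f k x \<and> f k x \<le> b) \<longrightarrow> a \<le> g x \<and> g x \<le> b)}" for n
  have C_fdom: "g \<in> fdom" if "g \<in> C n" for g n
    using that by (auto simp: C_def fdom_def less_top[symmetric] top_unique)
  have C_le: "e g \<le> c" if "g \<in> C n" for g n
  proof -
    have "q g \<le> ennreal c" using that by (simp add: C_def)
    thus ?thesis unfolding ennreal_e[OF C_fdom[OF that], symmetric] using c(1) by simp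
  qed
  \<comment> \<open>Midpoints are the only convex combinations that the parallelogram identity calls
    for.\<close>
  have C_mid: "(\<lambda>x. (1/2) * (g x + h x)) \<in> C n" if gh: "g \<in> C n" "h \<in> C n" for g h n
  proof -
    note fd = C_fdom[OF gh(1)] C_fdom[OF gh(2)]
    have mid: "(\<lambda>x. (1/2) * (g x + h x)) \<in> fdom"
      by (intro fdom_scale fdom_add fd)
    have "e (\<lambda>x. (1/2) * (g x + h x)) = (1/4) * e (\<lambda>x. g x + h x)"
      by (subst e_scale) (auto intro: fdom_add fd simp: power2_eq_square)
    also have "\<dots> \<le> (1/4) * (2 * e g + 2 * e h)"
      using e_parallelogram[OF fd] e_nonneg[of "\<lambda>x. g x - h x"] by simp
    also have "\<dots> \<le> c" using C_le[OF gh(1)] C_le[OF gh(2)] by simp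
    finally have "q (\<lambda>x. (1/2) * (g x + h x)) \<le> ennreal c"
      unfolding ennreal_e[OF mid, symmetric] by (rule ennreal_leI)
    moreover have "a \<le> (1/2) * (g x + h x) \<and> (1/2) * (g x + h x) \<le> b"
      if "\<forall>k\<ge>n. a \<le> f k x \<and> f k x \<le> b" for x a b
    proof -
      have "a \<le> g x \<and> g x \<le> b" "a \<le> h x \<and> h x \<le> b"
        using gh that unfolding C_def by blast+
      thus ?thesis by (simp add: field_simps)
    qed
    ultimately show ?thesis using fdom_measurable[OF mid] by (auto simp: C_def)
  qed
  have C_anti: "C m \<subseteq> C n" if "n \<le> m" for n m
    using that unfolding C_def by (blast intro: order_trans)
  have f_C: "f n \<in> C n" for n
    using f c by (auto simp: C_def)
  \<comment> \<open>As \<open>C n\<close> shrinks, these infima increase; bounded by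
    \<open>c\<close>, they converge, so late ones differ little.\<close>
  define I where "I n = Inf (e ` C n)" for n
  have bdd: "bdd_below (e ` C n)" for n
    by (rule bdd_belowI[of _ 0]) (auto simp: e_nonneg)
  have I_le: "I n \<le> e g" if "g \<in> C n" for n g
    unfolding I_def using that bdd by (intro cInf_lower) auto
  have I_c: "I n \<le> c" for n
    using I_le[OF f_C] C_le[OF f_C] order_trans by blast
  have I_mono: "I n \<le> I m" if "n \<le> m" for n m
    unfolding I_def using C_anti[OF that] f_C bdd by (intro cInf_superset_mono) auto
  define s where "s = (SUP n. I n)"
  have I_bdd: "bdd_above (range I)" by (rule bdd_aboveI2[OF I_c])
  have I_lim: "I \<longlonglongrightarrow> s"
    unfolding s_def using I_bdd I_mono by (intro LIMSEQ_incseq_SUP) (auto simp: incseq_def)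
  have I_s: "I n \<le> s" for n
    unfolding s_def using I_bdd by (intro cSUP_upper) auto
  define \<alpha> where "\<alpha> n = inverse (real (Suc n))" for n
  have \<alpha>: "0 < \<alpha> n" "n \<le> m \<Longrightarrow> \<alpha> m \<le> \<alpha> n" for n m
    unfolding \<alpha>_def by (simp_all add: le_imp_inverse_le)
  have "\<exists>g. g \<in> C n \<and> e g < I n + \<alpha> n" for n
    using cInf_lessD[of "e ` C n" "I n + \<alpha> n"] f_C \<alpha>(1) unfolding I_def by auto
  then obtain g where g: "\<And>n. g n \<in> C n" and g_less: "\<And>n. e (g n) < I n + \<alpha> n"
    by metis
  note g_fdom = C_fdom[OF g] and g_meas = fdom_measurable[OF C_fdom[OF g]]
  \<comment> \<open>For \<open>n \<le> m\<close> the midpoint of \<open>g n\<close> and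
    \<open>g m\<close> lies in \<open>C n\<close>, so the parallelogram law bounds their distance by
    \<open>2 * (I m - I n) + 2 * \<alpha> n + 2 * \<alpha> m\<close>; then
    \<open>I m \<le> s\<close> and \<open>\<alpha> m \<le> \<alpha> n\<close>.\<close>
  define \<beta> where "\<beta> n = 2 * (s - I n) + 4 * \<alpha> n" for n
  have "\<beta> \<longlonglongrightarrow> 2 * (s - s) + 4 * 0"
    unfolding \<beta>_def \<alpha>_def by (intro tendsto_intros I_lim LIMSEQ_inverse_real_of_nat)
  hence \<beta>_lim: "\<beta> \<longlonglongrightarrow> 0" by simp
  have e_g: "e (\<lambda>x. g n x - g m x) \<le> \<beta> n" if "n \<le> m" for n m
  proof -
    define a where "a = e (\<lambda>x. g n x + g m x)"
    define b where "b = e (\<lambda>x. g n x - g m x)"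
    have "g m \<in> C n" using g C_anti[OF that] by auto
    hence "I n \<le> e (\<lambda>x. (1/2) * (g n x + g m x))"
      using C_mid[OF g] I_le by blast
    also have "\<dots> = (1/4) * a"
      unfolding a_def by (subst e_scale) (auto intro: fdom_add g_fdom simp: power2_eq_square)
    finally have "4 * I n \<le> a" by simp
    moreover have "2 * e (g n) + 2 * e (g m) = a + b"
      unfolding a_def b_def by (rule e_parallelogram[OF g_fdom g_fdom])
    ultimately have "b \<le> \<beta> n"
      using \<alpha>(2)[OF that] g_less[of n] g_less[of m] I_s[of m] unfolding \<beta>_def by argo
    thus ?thesis by (simp add: b_def)
  qed
  let ?S = "sequentially \<times>\<^sub>F sequentially"
  have norm: "((\<lambda>(n, m). form_norm E (L0_diff M (L0_class M (g n)) (L0_class M (g m)))) \<longlongrightarrow> 0) ?S"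
  proof (rule tendstoI)
    fix r :: real assume r: "0 < r"
    hence "eventually (\<lambda>n. \<beta> n < r\<^sup>2) sequentially"
      using \<beta>_lim by (intro order_tendstoD(2)) auto
    then obtain N where N: "\<And>n. n \<ge> N \<Longrightarrow> \<beta> n < r\<^sup>2"
      by (auto simp: eventually_sequentially)
    have "sqrt (e (\<lambda>x. g n x - g m x)) < r" if "n \<ge> N" "m \<ge> N" for n m
    proof -
      have "e (\<lambda>x. g n x - g m x) < r\<^sup>2"
        using e_g[of n m] e_g[of m n] N[of n] N[of m] that e_diff_commute[OF g_fdom[of n] g_fdom[of m]]
        by (cases "n \<le> m") auto
      thus ?thesis using r by (simp add: real_less_lsqrt)
    qed
    thus "\<forall>\<^sub>F p in ?S. dist (case p of (n, m) \<Rightarrow>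
        form_norm E (L0_diff M (L0_class M (g n)) (L0_class M (g m)))) 0 < r"
      by (auto simp: eventually_prod_sequentially L0_diff_class_fdom g_fdom form_norm_class e_nonneg)
  qed
  have g_lim: "AE x in M. (\<lambda>n. g n x) \<longlonglongrightarrow> l x"
    using lim
  proof eventually_elim
    case (elim x)
    show ?case
    proof (rule LIMSEQ_I)
      fix r :: real assume "0 < r"
      \<comment> \<open>Half of \<open>r\<close> is taken because \<open>C N\<close> transfers only
        non-strict bounds, here \<open>l x - r / 2\<close> and \<open>l x + r / 2\<close>.\<close>
      then obtain N where N: "\<And>k. k \<ge> N \<Longrightarrow> norm (f k x - l x) < r / 2"
        using LIMSEQ_D[OF elim, of "r / 2"] by auto
      have "norm (g n x - l x) < r" if "n \<ge> N" for n
      proof -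
        have "\<forall>k\<ge>N. l x - r / 2 \<le> f k x \<and> f k x \<le> l x + r / 2"
          using N unfolding real_norm_def abs_diff_less_iff by (meson less_imp_le)
        moreover have "g n \<in> C N" using g C_anti[OF that] by auto
        ultimately have "l x - r / 2 \<le> g n x \<and> g n x \<le> l x + r / 2"
          unfolding C_def by blast
        hence "l x - r < g n x" "g n x < l x + r" using \<open>0 < r\<close> by auto
        thus ?thesis by (simp add: abs_diff_less_iff)
      qed
      thus "\<exists>N. \<forall>n\<ge>N. norm (g n x - l x) < r" by blast
    qed
  qed
  let ?d = "\<lambda>U f g. L0_dist M U (L0_class M f) (L0_class M g)"
  have tri: "?d U u w \<le> ?d U v u + ?d U v w"
    if "U \<in> sets M" "emeasure M U < \<infinity>" "u \<in> borel_measurable M" "v \<in> borel_measurable M"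
      "w \<in> borel_measurable M" for U u v w
    using L0_dist_triangle[of "L0_class M u" M "L0_class M v" "L0_class M w" U] that
    by (simp add: L0_class_in_L0 L0_dist_commute)
  have dist: "((\<lambda>(n, m). ?d U (g n) (g m)) \<longlongrightarrow> 0) ?S" if U: "U \<in> sets M" "emeasure M U < \<infinity>" for U
  proof (rule tendstoI)
    fix r :: real assume r: "0 < r"
    have "(\<lambda>n. ?d U (g n) l) \<longlonglongrightarrow> 0"
      by (rule L0_dist_tendsto_AE[OF g_meas l g_lim U])
    hence "eventually (\<lambda>n. ?d U (g n) l < r / 2) sequentially"
      using r by (intro order_tendstoD(2)) auto
    then obtain N where N: "\<And>n. n \<ge> N \<Longrightarrow> ?d U (g n) l < r / 2"
      by (auto simp: eventually_sequentially)
    have "?d U (g n) (g m) < r" if "n \<ge> N" "m \<ge> N" for n m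
      using tri[OF U g_meas[of n] l g_meas[of m]] N[OF that(1)] N[OF that(2)]
      by (simp add: L0_dist_commute)
    thus "\<forall>\<^sub>F p in ?S. dist (case p of (n, m) \<Rightarrow> ?d U (g n) (g m)) 0 < r"
      by (auto simp: eventually_prod_sequentially L0_dist_nonneg)
  qed
  obtain u where u: "u \<in> form_domain M E"
    and u_norm: "(\<lambda>n. form_norm E (L0_diff M (L0_class M (g n)) u)) \<longlonglongrightarrow> 0"
    and u_dist: "\<And>U. U \<in> sets M \<Longrightarrow> emeasure M U < \<infinity> \<Longrightarrow> (\<lambda>n. L0_dist M U (L0_class M (g n)) u) \<longlonglongrightarrow> 0"
    using closed_form_sequence[OF closed form_domain_class[OF g_fdom] norm dist] by metis
  obtain h where h: "h \<in> fdom" "u = L0_class M h" using u by (rule form_domain_cases)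
  note hm = fdom_measurable[OF h(1)]
  \<comment> \<open>Closedness supplies some limit \<open>h\<close>; since \<open>g n\<close> also
    tends to \<open>l\<close> locally in measure, the two limits agree.\<close>
  have "AE x in M. l x = h x"
  proof (rule L0_eq_of_L0_dist[OF semi_finite l hm])
    fix U assume U: "U \<in> sets M" "emeasure M U < \<infinity>"
    have "(\<lambda>n. ?d U (g n) l + ?d U (g n) h) \<longlonglongrightarrow> 0 + 0"
      using L0_dist_tendsto_AE[OF g_meas l g_lim U] u_dist[OF U] unfolding h(2) by (rule tendsto_add)
    hence "?d U l h \<le> 0"
      by (intro LIMSEQ_le_const[where X = "\<lambda>n. ?d U (g n) l + ?d U (g n) h"])
        (auto intro!: tri U l hm g_meas)
    thus "?d U l h = 0" using L0_dist_nonneg[of M U] by (intro antisym) auto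
  qed
  hence "q l = q h" by (rule q_cong_AE[OF l hm])
  also have "\<dots> = ennreal (e h)" by (simp add: ennreal_e h(1))
  also have "\<dots> \<le> ennreal c"
  proof (rule ennreal_leI)
    \<comment> \<open>The seminorm is continuous for form convergence, so the bound on
      \<open>g n\<close> passes to \<open>h\<close>.\<close>
    have "(\<lambda>n. sqrt c + sqrt (e (\<lambda>x. g n x - h x))) \<longlonglongrightarrow> sqrt c + 0"
      using u_norm by (intro tendsto_intros) (simp add: h L0_diff_class_fdom g_fdom form_norm_class)
    moreover have "sqrt (e h) \<le> sqrt c + sqrt (e (\<lambda>x. g n x - h x))" for n
    proof -
      have "sqrt (e h) \<le> sqrt (e (g n)) + sqrt (e (\<lambda>x. h x - g n x))"
        using e_triangle[OF g_fdom[of n] fdom_diff[OF h(1) g_fdom[of n]]] by simp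
      also have "\<dots> \<le> sqrt c + sqrt (e (\<lambda>x. g n x - h x))"
        using C_le[OF g[of n]] by (simp add: e_diff_commute[OF h(1) g_fdom[of n]])
      finally show ?thesis .
    qed
    ultimately have "sqrt (e h) \<le> sqrt c" by (intro LIMSEQ_le_const) auto
    thus "e h \<le> c" by simp
  qed
  finally show ?thesis .
qed

end

section \<open>Markovian forms\<close>

definition clamp01 :: "real \<Rightarrow> real" where
  "clamp01 t = max 0 (min 1 t)"

lemma clamp01_nonneg: "0 \<le> clamp01 t"
  and clamp01_le_1: "clamp01 t \<le> 1"
  and clamp01_id: "0 \<le> t \<Longrightarrow> t \<le> 1 \<Longrightarrow> clamp01 t = t"
  and clamp01_mono: "s \<le> t \<Longrightarrow> clamp01 s \<le> clamp01 t"
  and clamp01_add_minus: "clamp01 t + clamp01 (- t) = min \<bar>t\<bar> 1"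
  by (auto simp: clamp01_def)

lemma measurable_clamp01 [measurable]: "clamp01 \<in> borel_measurable borel"
  unfolding clamp01_def by measurable

text \<open>On the unit interval both maps are the identity; outside, monotonicity and the values at
  0 and 1 confine \<open>C t\<close> to \<open>[-r, 0]\<close> or \<open>[1, 1 + r]\<close>.\<close>

lemma cutoff_near_clamp01:
  assumes "cutoff r C"
  shows "\<bar>C t - clamp01 t\<bar> \<le> r"
proof -
  have C: "mono C" "\<And>t. - r \<le> C t" "\<And>t. C t \<le> 1 + r" "\<And>t. 0 \<le> t \<Longrightarrow> t \<le> 1 \<Longrightarrow> C t = t"
    using assms by (auto simp: cutoff_def image_subset_iff)
  have r: "0 \<le> r" using C(3)[of 1] C(4)[of 1] by simp
  have lo: "C t \<le> 0" if "t \<le> 0" using monoD[OF C(1) that] C(4)[of 0] by simp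
  have hi: "1 \<le> C t" if "1 \<le> t" using monoD[OF C(1) that] C(4)[of 1] by simp
  show ?thesis
    using C(2)[of t] C(3)[of t] C(4)[of t] lo hi r
    by (cases "t \<le> 0"; cases "t \<le> 1") (auto simp: clamp01_def abs_le_iff)
qed

section \<open>Unit contractions and tail sums of small energy\<close>

locale L0_energy_form = closed_L0_form +
  assumes Markovian: "Markovian M E"
begin

text \<open>Cutoffs with \<epsilon> tending to 0 converge to \<open>clamp01\<close>, and lower
  semicontinuity carries their energy bound to the limit.\<close>

lemma q_clamp01_le:
  assumes f: "f \<in> borel_measurable M"
  shows "q (\<lambda>x. clamp01 (f x)) \<le> q f"
proof (cases "q f = \<infinity>")
  case False
  hence fd: "f \<in> fdom" using f by (simp add: fdom_def less_top)
  have "\<exists>C. cutoff (1 / real (Suc n)) C \<and> (\<forall>u\<in>L0 M. E (L0_comp M C u) \<le> E u)" for n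
    using Markovian unfolding Markovian_def by simp
  then obtain C where C: "\<And>n. cutoff (1 / real (Suc n)) (C n)"
    and EC: "\<And>n u. u \<in> L0 M \<Longrightarrow> E (L0_comp M (C n) u) \<le> E u"
    by metis
  have C_meas: "C n \<in> borel_measurable borel" for n
    using C[of n] by (intro borel_measurable_mono) (simp add: cutoff_def)
  have "q (\<lambda>x. clamp01 (f x)) \<le> ennreal (e f)"
  proof (rule q_le_of_AE_limit)
    show "C n \<circ> f \<in> borel_measurable M" for n
      by (rule measurable_comp[OF f C_meas])
    show "(\<lambda>x. clamp01 (f x)) \<in> borel_measurable M" using f by measurable
    show "0 \<le> e f" by (rule e_nonneg)
    show "q (C n \<circ> f) \<le> ennreal (e f)" for n
      using EC[OF L0_class_in_L0[OF f], of n]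
      by (simp add: ennreal_e fd) (simp add: q_def L0_comp_class[OF f f C_meas])
    show "AE x in M. (\<lambda>n. (C n \<circ> f) x) \<longlonglongrightarrow> clamp01 (f x)"
    proof (rule AE_I2)
      fix x
      have "(\<lambda>n. C n (f x) - clamp01 (f x)) \<longlonglongrightarrow> 0"
        by (rule Lim_null_comparison[OF _ LIMSEQ_inverse_real_of_nat])
          (use cutoff_near_clamp01[OF C] in \<open>simp add: inverse_eq_divide\<close>)
      thus "(\<lambda>n. (C n \<circ> f) x) \<longlonglongrightarrow> clamp01 (f x)" by (simp add: LIM_zero_iff)
    qed
  qed
  thus ?thesis by (simp add: ennreal_e fd)
qed simp

text \<open>The crude bound of \<open>q_add_le\<close> suffices for ratio 1/4: the constant 4 solves
  \<open>c = 2 + 2 * c / 4\<close>. The bound is uniform in \<open>k\<close>, and peeling off the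
  first term shifts \<open>N\<close>.\<close>

lemma q_geometric_sum_le:
  assumes p: "\<And>n. p n \<in> borel_measurable M" "\<And>n. q (p n) \<le> ennreal ((1/4) ^ n)"
  shows "q (\<lambda>x. \<Sum>i<k. p (N + i) x) \<le> ennreal (4 * (1/4) ^ N)"
proof (induction k arbitrary: N)
  case 0
  have "q (\<lambda>x. 0) = 0" using ennreal_e[OF fdom_zero] by (simp add: e_zero)
  thus ?case by simp
next
  case (Suc k)
  have "q (\<lambda>x. \<Sum>i<Suc k. p (N + i) x) = q (\<lambda>x. p N x + (\<Sum>i<k. p (Suc N + i) x))"
    by (simp add: sum.lessThan_Suc_shift del: sum.lessThan_Suc)
  also have "\<dots> \<le> 2 * q (p N) + 2 * q (\<lambda>x. \<Sum>i<k. p (Suc N + i) x)"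
    using p(1) by (intro q_add_le) auto
  also have "\<dots> \<le> 2 * ennreal ((1/4) ^ N) + 2 * ennreal (4 * (1/4) ^ Suc N)"
    by (intro add_mono mult_left_mono p(2) Suc.IH) auto
  also have "\<dots> = ennreal (2 * (1/4) ^ N + 2 * (4 * (1/4) ^ Suc N))"
    by (subst ennreal_plus) (auto simp: ennreal_mult simp del: power_Suc)
  also have "\<dots> = ennreal (4 * (1/4) ^ N)" by simp
  finally show ?case .
qed

text \<open>The hypothesis \<open>trans\<close> is transience for functions. With
  \<open>clamp01\<close> the counterexamples become nonnegative, so their truncated sums are
  monotone.\<close>

lemma clamp01_integral_small:
  assumes trans: "\<And>f. f \<in> borel_measurable M \<Longrightarrow> q f = 0 \<Longrightarrow> AE x in M. f x = 0"
    and U: "U \<in> sets M" "emeasure M U < \<infinity>" and \<delta>: "0 < \<delta>"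
  obtains \<eta> where "0 < \<eta>"
    "\<And>f. f \<in> borel_measurable M \<Longrightarrow> q f \<le> ennreal \<eta> \<Longrightarrow> (LINT x:U|M. clamp01 (f x)) < \<delta>"
proof (rule ccontr)
  assume "\<not> thesis"
  \<comment> \<open>The thresholds are chosen to match \<open>q_geometric_sum_le\<close>.\<close>
  hence "\<exists>f\<in>borel_measurable M. q f \<le> ennreal ((1/4) ^ n) \<and> \<not> (LINT x:U|M. clamp01 (f x)) < \<delta>" for n
    using that[of "(1/4) ^ n"] by auto
  then obtain f where f: "\<And>n. f n \<in> borel_measurable M" "\<And>n. q (f n) \<le> ennreal ((1/4) ^ n)"
    and f_int: "\<And>n. \<delta> \<le> (LINT x:U|M. clamp01 (f n x))"
    by (metis not_less)
  define p where "p n x = clamp01 (f n x)" for n x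
  have p_meas [measurable]: "p n \<in> borel_measurable M" for n
    unfolding p_def using f(1)[of n] by measurable
  have p_q: "q (p n) \<le> ennreal ((1/4) ^ n)" for n
    unfolding p_def using q_clamp01_le[OF f(1)] f(2) by (rule order_trans)
  have p_01: "0 \<le> p n x" "p n x \<le> 1" for n x
    by (auto simp: p_def clamp01_nonneg clamp01_le_1)
  define r where "r N k x = clamp01 (\<Sum>i<k. p (N + i) x)" for N k x
  have r_meas [measurable]: "r N k \<in> borel_measurable M" for N k
    unfolding r_def by measurable
  have r_q: "q (r N k) \<le> ennreal (4 * (1/4) ^ N)" for N k
    unfolding r_def
    by (rule order_trans[OF q_clamp01_le q_geometric_sum_le[OF p_meas p_q]]) measurable
  have r_bdd: "bdd_above (range (\<lambda>k. r N k x))" for N x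
    by (rule bdd_aboveI2[of _ _ 1]) (simp add: r_def clamp01_le_1)
  have r_inc: "incseq (\<lambda>k. r N k x)" for N x
    unfolding r_def incseq_Suc_iff by (auto intro!: clamp01_mono p_01)
  \<comment> \<open>The larger sum has the extra nonnegative term \<open>p N\<close>; this makes
    \<open>h\<close> decreasing in \<open>N\<close>.\<close>
  have r_shift: "r (Suc N) k x \<le> r N (Suc k) x" for N k x
    unfolding r_def
    by (intro clamp01_mono) (simp add: sum.lessThan_Suc_shift p_01 del: sum.lessThan_Suc)
  define h where "h N x = (SUP k. r N k x)" for N x
  have r_h: "r N k x \<le> h N x" for N k x
    unfolding h_def by (rule cSUP_upper[OF _ r_bdd]) simp
  have r_lim: "(\<lambda>k. r N k x) \<longlonglongrightarrow> h N x" for N x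
    unfolding h_def by (rule LIMSEQ_incseq_SUP[OF r_bdd r_inc])
  have h_meas [measurable]: "h N \<in> borel_measurable M" for N
    by (rule borel_measurable_LIMSEQ_real[OF r_lim r_meas])
  \<comment> \<open>First use of lower semicontinuity, for \<open>k\<close> tending to infinity; the
    second, for \<open>N\<close>, gives \<open>l_q\<close>.\<close>
  have h_q: "q (h N) \<le> ennreal (4 * (1/4) ^ N)" for N
    by (rule q_le_of_AE_limit[OF r_meas h_meas AE_I2[OF r_lim] _ r_q]) simp
  \<comment> \<open>A single summand is unchanged by truncation, so \<open>h N\<close> inherits the
    lower bound on the integral of \<open>p N\<close>.\<close>
  have p_h: "p N x \<le> h N x" for N x
    using r_h[of N 1 x] by (simp add: r_def clamp01_id p_01)
  have h_0: "0 \<le> h N x" for N x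
    using p_h p_01(1) by (rule order_trans[rotated])
  have h_1: "h N x \<le> 1" for N x
    unfolding h_def by (rule cSUP_least) (auto simp: r_def clamp01_le_1)
  have h_dec: "decseq (\<lambda>N. h N x)" for x
    unfolding decseq_Suc_iff
    by (subst (1) h_def) (auto intro!: cSUP_least order_trans[OF r_shift r_h])
  define l where "l x = (INF N. h N x)" for x
  have h_lim: "(\<lambda>N. h N x) \<longlonglongrightarrow> l x" for x
    unfolding l_def by (intro LIMSEQ_decseq_INF h_dec bdd_belowI2[of _ 0] h_0)
  have l_meas [measurable]: "l \<in> borel_measurable M"
    by (rule borel_measurable_LIMSEQ_real[OF h_lim h_meas])
  have l_q: "q l \<le> ennreal (4 * (1/4) ^ N)" for N
  \<comment> \<open>Starting the sequence at \<open>N\<close> gives all its members the energy bound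
    of \<open>h N\<close>.\<close>
  proof (rule q_le_of_AE_limit[where f = "\<lambda>n. h (n + N)"])
    show "AE x in M. (\<lambda>n. h (n + N) x) \<longlonglongrightarrow> l x"
      by (rule AE_I2) (rule LIMSEQ_ignore_initial_segment[OF h_lim])
    show "q (h (n + N)) \<le> ennreal (4 * (1/4) ^ N)" for n
      by (rule order_trans[OF h_q]) (auto intro!: ennreal_leI power_decreasing)
  qed auto
  have "(\<lambda>N. ennreal (4 * (1/4) ^ N)) \<longlonglongrightarrow> ennreal (4 * 0)"
    by (intro tendsto_ennrealI tendsto_intros LIMSEQ_power_zero) simp
  hence "q l \<le> 0"
    using l_q by (intro LIMSEQ_le_const) auto
  hence "AE x in M. l x = 0" by (intro trans) auto
  hence "AE x in M. (\<lambda>N. h N x) \<longlonglongrightarrow> 0"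
    by eventually_elim (metis h_lim)
  \<comment> \<open>Since \<open>0 \<le> h N \<le> 1\<close>, this distance is the integral of
    \<open>h N\<close> over \<open>U\<close>, which was bounded below by
    \<open>\<delta>\<close>.\<close>
  hence "(\<lambda>N. L0_dist M U (L0_class M (h N)) (L0_class M (\<lambda>x. 0))) \<longlonglongrightarrow> 0"
    by (intro L0_dist_tendsto_AE h_meas U) auto
  hence "(\<lambda>N. LINT x:U|M. h N x) \<longlonglongrightarrow> 0"
    by (simp add: L0_dist_class h_meas U(1) h_0 h_1)
  moreover have "\<delta> \<le> (LINT x:U|M. h N x)" for N
  proof -
    have "\<delta> \<le> (LINT x:U|M. p N x)" using f_int by (simp add: p_def)
    also have "\<dots> \<le> (LINT x:U|M. h N x)"
      using p_01 h_0 h_1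
      by (intro set_integral_mono set_integrable_finite_bounded[OF _ _ U] p_meas h_meas p_h) auto
    finally show ?thesis .
  qed
  ultimately have "\<delta> \<le> 0" by (intro LIMSEQ_le_const) auto
  thus False using \<delta> by simp
qed

text \<open>Since \<open>min \<bar>t\<bar> 1 = clamp01 t + clamp01 (- t)\<close>, the one-sided
  estimate is applied to \<open>f\<close> and \<open>- f\<close>, which have equal energy, with
  \<open>\<delta> / 2\<close> each.\<close>

lemma L0_dist_zero_small:
  assumes trans: "\<And>f. f \<in> borel_measurable M \<Longrightarrow> q f = 0 \<Longrightarrow> AE x in M. f x = 0"
    and U: "U \<in> sets M" "emeasure M U < \<infinity>" and \<delta>: "0 < \<delta>"
  obtains \<eta> where "0 < \<eta>"
    "\<And>u. u \<in> form_domain M E \<Longrightarrow> form_norm E u < \<eta> \<Longrightarrow> L0_dist M U u (L0_zero M) < \<delta>"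
proof -
  obtain \<eta> where \<eta>: "0 < \<eta>"
    and small: "\<And>f. f \<in> borel_measurable M \<Longrightarrow> q f \<le> ennreal \<eta> \<Longrightarrow> (LINT x:U|M. clamp01 (f x)) < \<delta> / 2"
    using clamp01_integral_small[OF trans U, of "\<delta> / 2"] \<delta> by auto
  show ?thesis
  proof
    show "0 < sqrt \<eta>" using \<eta> by simp
    fix u assume u: "u \<in> form_domain M E" "form_norm E u < sqrt \<eta>"
    then obtain f where f: "f \<in> fdom" "u = L0_class M f" by (metis form_domain_cases)
    note fm [measurable] = fdom_measurable[OF f(1)]
    have "e f < \<eta>" using u(2) by (simp add: f(2) form_norm_class)
    hence "q f \<le> ennreal \<eta>" "q (\<lambda>x. - f x) \<le> ennreal \<eta>"
      using q_scale[OF fm, of "-1"] by (simp_all flip: ennreal_e[OF f(1)] add: ennreal_leI less_imp_le)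
    hence "(LINT x:U|M. clamp01 (f x)) < \<delta> / 2" "(LINT x:U|M. clamp01 (- f x)) < \<delta> / 2"
      using small[OF fm] small[of "\<lambda>x. - f x"] by simp_all
    moreover have "(LINT x:U|M. min \<bar>f x - 0\<bar> 1)
        = (LINT x:U|M. clamp01 (f x)) + (LINT x:U|M. clamp01 (- f x))"
      by (subst set_integral_add(2)[symmetric])
        (auto intro!: set_integrable_finite_bounded[OF _ _ U] simp: clamp01_nonneg clamp01_le_1 clamp01_add_minus)
    ultimately show "L0_dist M U u (L0_zero M) < \<delta>"
      by (simp add: f(2) L0_zero_def L0_dist_class U(1))
  qed
qed

end

section \<open>Transience, continuity and completeness\<close>

lemma transient_AE_zero:
  assumes "transient M E" "f \<in> borel_measurable M" "E (L0_class M f) = 0"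
  shows "AE x in M. f x = 0"
proof -
  have "L0_class M f \<in> form_kernel M E"
    using assms by (simp add: form_kernel_def L0_class_in_L0)
  hence "L0_class M f = L0_class M (\<lambda>x. 0)"
    using assms(1) by (simp add: transient_def L0_zero_def)
  thus ?thesis using assms(2) by (intro L0_class_eq_AE) auto
qed

context L0_quadratic_form
begin

lemma transientI:
  assumes "\<And>f. f \<in> borel_measurable M \<Longrightarrow> q f = 0 \<Longrightarrow> AE x in M. f x = 0"
  shows "transient M E"
  unfolding transient_def
proof
  show "form_kernel M E \<subseteq> {L0_zero M}"
  proof
    fix u assume "u \<in> form_kernel M E"
    then obtain f where f: "f \<in> borel_measurable M" "u = L0_class M f" "q f = 0"
      by (auto simp: form_kernel_def q_def elim!: L0_cases)
    thus "u \<in> {L0_zero M}"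
      using L0_class_eqI[OF f(1) _ assms[OF f(1,3)]] by (simp add: L0_zero_def)
  qed
  have "q (\<lambda>x. 0) = 0" using ennreal_e[OF fdom_zero] by (simp add: e_zero)
  thus "{L0_zero M} \<subseteq> form_kernel M E"
    by (simp add: form_kernel_def L0_zero_in_L0) (simp add: q_def L0_zero_def)
qed

lemma L0_add_class_fdom:
  "f \<in> fdom \<Longrightarrow> g \<in> fdom \<Longrightarrow> L0_add M (L0_class M f) (L0_class M g) = L0_class M (\<lambda>x. f x + g x)"
  by (intro L0_add_class fdom_measurable)

lemma L0_scale_class_fdom:
  "f \<in> fdom \<Longrightarrow> L0_scale M c (L0_class M f) = L0_class M (\<lambda>x. c * f x)"
  using L0_scale_class[of f M f c] by (simp add: fdom_measurable)

lemma form_inner_class: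
  "f \<in> fdom \<Longrightarrow> g \<in> fdom \<Longrightarrow> form_inner M E (L0_class M f) (L0_class M g) = B f g"
  by (simp add: form_inner_def B_def L0_add_class_fdom L0_diff_class_fdom e_def q_def)

lemmas fdom_class_simps = L0_add_class_fdom L0_scale_class_fdom L0_diff_class_fdom
  form_inner_class fdom_closed L0_zero_def

text \<open>The linear and bilinear axioms are inherited from representatives; transience provides
  definiteness.\<close>

lemma transient_imp_inner_product_space:
  assumes "transient M E"
  shows "real_inner_product_space_on (form_domain M E) (L0_add M) (L0_scale M) (L0_zero M)
    (form_inner M E)"
proof
  fix u v w :: "('a \<Rightarrow> real) set" and c d :: real
  show "L0_zero M \<in> form_domain M E" by (rule form_domain_zero)
  assume u: "u \<in> form_domain M E"
  then obtain f where f: "f \<in> fdom" "u = L0_class M f" by (rule form_domain_cases)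
  show "L0_scale M c u \<in> form_domain M E"
    by (simp add: f fdom_class_simps form_domain_class)
  show "L0_add M u (L0_zero M) = u" "L0_add M u (L0_scale M (- 1) u) = L0_zero M"
    "L0_scale M (c + d) u = L0_add M (L0_scale M c u) (L0_scale M d u)"
    "L0_scale M c (L0_scale M d u) = L0_scale M (c * d) u" "L0_scale M 1 u = u"
    using fdom_scale[OF f(1), of "-1"] by (simp_all add: f fdom_class_simps algebra_simps)
  show "0 \<le> form_inner M E u u"
    by (simp add: f fdom_class_simps B_self e_nonneg)
  show "form_inner M E u u = 0 \<longleftrightarrow> u = L0_zero M"
  proof
    assume "form_inner M E u u = 0"
    hence "q f = 0"
      using ennreal_e[OF f(1)] by (simp add: f fdom_class_simps B_self)
    hence "AE x in M. f x = 0"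
      using transient_AE_zero[OF assms fdom_measurable[OF f(1)]] by (simp add: q_def)
    thus "u = L0_zero M"
      unfolding f L0_zero_def by (intro L0_class_eqI fdom_measurable f fdom_zero) auto
  next
    assume "u = L0_zero M"
    thus "form_inner M E u u = 0"
      using form_inner_class[OF fdom_zero fdom_zero] by (simp add: L0_zero_def B_zero fdom_zero)
  qed
  assume v: "v \<in> form_domain M E"
  then obtain g where g: "g \<in> fdom" "v = L0_class M g" by (rule form_domain_cases)
  show "L0_add M u v \<in> form_domain M E"
    by (simp add: f g fdom_class_simps form_domain_class)
  show "L0_add M u v = L0_add M v u"
    "L0_scale M c (L0_add M u v) = L0_add M (L0_scale M c u) (L0_scale M c v)"
    by (simp_all add: f g fdom_class_simps algebra_simps)
  show "form_inner M E u v = form_inner M E v u"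
    by (simp add: f g fdom_class_simps B_commute)
  show "form_inner M E (L0_scale M c u) v = c * form_inner M E u v"
    by (simp add: f g fdom_class_simps B_scale_left)
  assume w: "w \<in> form_domain M E"
  then obtain h where h: "h \<in> fdom" "w = L0_class M h" by (rule form_domain_cases)
  show "L0_add M (L0_add M u v) w = L0_add M u (L0_add M v w)"
    by (simp add: f g h fdom_class_simps algebra_simps)
  show "form_inner M E (L0_add M u v) w = form_inner M E u w + form_inner M E v w"
    by (simp add: f g h fdom_class_simps B_add_left)
qed

lemma ip_dist_form:
  assumes "u \<in> form_domain M E" "v \<in> form_domain M E"
  shows "ip_dist (form_domain M E) (L0_add M) (L0_scale M) (form_inner M E) u v
    = form_norm E (L0_diff M u v)"
proof -
  obtain f g where f: "f \<in> fdom" "u = L0_class M f" and g: "g \<in> fdom" "v = L0_class M g"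
    using assms by (metis form_domain_cases)
  have "(\<lambda>x. - g x) \<in> fdom" using fdom_scale[OF g(1), of "-1"] by simp
  hence "L0_add M u (L0_scale M (- 1) v) = L0_class M (\<lambda>x. f x - g x)"
    by (simp add: f g fdom_class_simps)
  thus ?thesis
    using assms by (simp add: ip_dist_def f g fdom_class_simps B_self form_norm_class)
qed

lemma inner_product_space_imp_transient:
  assumes "real_inner_product_space_on (form_domain M E) (L0_add M) (L0_scale M) (L0_zero M)
    (form_inner M E)"
  shows "transient M E"
proof (rule transientI)
  fix f assume f: "f \<in> borel_measurable M" "q f = 0"
  hence fd: "f \<in> fdom" by (simp add: fdom_def)
  have "form_inner M E (L0_class M f) (L0_class M f) = 0"
    using f(2) by (simp add: form_inner_class fd B_self e_def)
  hence "L0_class M f = L0_class M (\<lambda>x. 0)"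
    using real_inner_product_space_on.ip_eq_zero_iff[OF assms form_domain_class[OF fd]]
    by (simp add: L0_zero_def)
  thus "AE x in M. f x = 0" using f(1) by (intro L0_class_eq_AE) auto
qed

text \<open>The filter is arbitrary so that constant sequences and double sequences of differences
  are both covered.\<close>

lemma continuous_embedding_L0_dist_tendsto:
  assumes "continuous_map (seminorm_topology M E) (L0_topology M) (\<lambda>f. f)"
    and \<phi>: "\<And>i. \<phi> i \<in> form_domain M E" and "((\<lambda>i. form_norm E (\<phi> i)) \<longlongrightarrow> 0) F"
    and U: "U \<in> sets M" "emeasure M U < \<infinity>"
  shows "((\<lambda>i. L0_dist M U (\<phi> i) (L0_zero M)) \<longlongrightarrow> 0) F"
proof -
  note \<phi>L = subsetD[OF form_domain_subset \<phi>]
  have "limitin (seminorm_topology M E) \<phi> (L0_zero M) F"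
    using assms(3) by (simp add: limitin_seminorm_topology \<phi> form_domain_zero L0_diff_zero \<phi>L)
  from continuous_map_limit[OF assms(1) this]
  show ?thesis
    using U by (simp add: comp_def limitin_L0_topology[OF \<phi>L L0_zero_in_L0])
qed

end

section \<open>Consequences of a continuous embedding\<close>

context closed_L0_form
begin

text \<open>A function of zero energy, as a constant sequence, tends to zero in the seminorm; by
  continuity its local distances to zero vanish.\<close>

lemma continuous_embedding_imp_transient:
  assumes cont: "continuous_map (seminorm_topology M E) (L0_topology M) (\<lambda>f. f)"
  shows "transient M E"
proof (rule transientI)
  fix f assume f: "f \<in> borel_measurable M" "q f = 0"
  hence fd: "f \<in> fdom" by (simp add: fdom_def)
  show "AE x in M. f x = 0"
  proof (rule L0_eq_of_L0_dist[OF semi_finite f(1)])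
    fix U assume U: "U \<in> sets M" "emeasure M U < \<infinity>"
    have "(\<lambda>n::nat. L0_dist M U (L0_class M f) (L0_zero M)) \<longlonglongrightarrow> 0"
      by (rule continuous_embedding_L0_dist_tendsto[OF cont form_domain_class[OF fd] _ U])
        (simp add: form_norm_class e_def f(2))
    thus "L0_dist M U (L0_class M f) (L0_class M (\<lambda>x. 0)) = 0"
      by (simp add: LIMSEQ_const_iff L0_zero_def)
  qed simp
qed

text \<open>Continuity makes a norm-Cauchy sequence Cauchy in the form topology, so closedness
  yields a limit, in particular in norm.\<close>

lemma continuous_embedding_imp_Hilbert:
  assumes cont: "continuous_map (seminorm_topology M E) (L0_topology M) (\<lambda>f. f)"
  shows "real_Hilbert_space_on (form_domain M E) (L0_add M) (L0_scale M) (L0_zero M)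
    (form_inner M E)"
proof -
  interpret real_inner_product_space_on "form_domain M E" "L0_add M" "L0_scale M" "L0_zero M"
    "form_inner M E"
    by (intro transient_imp_inner_product_space continuous_embedding_imp_transient cont)
  let ?d = "ip_dist (form_domain M E) (L0_add M) (L0_scale M) (form_inner M E)"
  interpret D: Metric_space "form_domain M E" ?d by (rule Metric_space_ip_dist)
  let ?S = "sequentially \<times>\<^sub>F sequentially"
  have "D.mcomplete"
    unfolding D.mcomplete_def
  proof safe
    fix g assume "D.MCauchy g"
    hence g: "\<And>n. g n \<in> form_domain M E"
      and cauchy: "\<And>r. 0 < r \<Longrightarrow> \<exists>N. \<forall>n m. N \<le> n \<longrightarrow> N \<le> m \<longrightarrow> ?d (g n) (g m) < r"
      by (auto simp: D.MCauchy_def)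
    note gL = subsetD[OF form_domain_subset g]
    have norm: "((\<lambda>p. form_norm E (L0_diff M (g (fst p)) (g (snd p)))) \<longlongrightarrow> 0) ?S"
    proof (rule tendstoI)
      fix r :: real assume "0 < r"
      from cauchy[OF this] show "\<forall>\<^sub>F p in ?S. dist (form_norm E (L0_diff M (g (fst p)) (g (snd p)))) 0 < r"
        unfolding eventually_prod_sequentially by (simp add: ip_dist_form g form_norm_nonneg) metis
    qed
    \<comment> \<open>The embedding is applied to the differences, since no limit of
      \<open>g\<close> is known yet.\<close>
    have dist: "((\<lambda>p. L0_dist M U (g (fst p)) (g (snd p))) \<longlongrightarrow> 0) ?S"
      if U: "U \<in> sets M" "emeasure M U < \<infinity>" for U
      using continuous_embedding_L0_dist_tendsto[OF cont _ norm U]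
      by (simp add: form_domain_diff g L0_dist_diff_zero gL U(1))
    obtain u where "u \<in> form_domain M E" "(\<lambda>n. form_norm E (L0_diff M (g n) u)) \<longlonglongrightarrow> 0"
      using closed_form_sequence[OF closed g, unfolded case_prod_unfold, OF norm dist] by blast
    thus "\<exists>u. limitin D.mtopology g u sequentially"
      by (auto simp: D.limitin_metric_dist_null ip_dist_form g)
  qed
  thus ?thesis by unfold_locales
qed

end

section \<open>Transience makes the embedding continuous\<close>

context L0_energy_form
begin

text \<open>Translation invariance moves the smallness estimate at zero to every point
  \<open>u\<close>, so preimages of subbasic balls are open.\<close>

lemma transient_imp_continuous_embedding:
  assumes "transient M E"
  shows "continuous_map (seminorm_topology M E) (L0_topology M) (\<lambda>f. f)"
  unfolding L0_topology_def
proof (rule continuous_on_generated_topo)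
  let ?N = "\<lambda>u v. form_norm E (L0_diff M u v)"
  fix S
  assume "S \<in> {{v \<in> L0 M. L0_dist M U u v < r} | u U r.
    u \<in> L0 M \<and> U \<in> sets M \<and> emeasure M U < \<infinity> \<and> 0 < r}"
  then obtain w U r where S: "S = {v \<in> L0 M. L0_dist M U w v < r}"
    and w: "w \<in> L0 M" and U: "U \<in> sets M" "emeasure M U < \<infinity>" by blast
  show "openin (seminorm_topology M E) ((\<lambda>f. f) -` S \<inter> topspace (seminorm_topology M E))"
    unfolding topspace_seminorm_topology
  proof (subst openin_subopen, intro ballI)
    fix u assume "u \<in> (\<lambda>f. f) -` S \<inter> form_domain M E"
    hence u: "u \<in> form_domain M E" "u \<in> L0 M" "L0_dist M U w u < r"
      by (auto simp: S)
    \<comment> \<open>The tolerance is the slack left at \<open>u\<close> inside the ball around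
      \<open>w\<close>.\<close>
    obtain \<eta> where \<eta>: "0 < \<eta>" and small: "\<And>v. v \<in> form_domain M E \<Longrightarrow> form_norm E v < \<eta> \<Longrightarrow>
        L0_dist M U v (L0_zero M) < r - L0_dist M U w u"
      using L0_dist_zero_small[OF _ U, of "r - L0_dist M U w u"] transient_AE_zero[OF assms] u(3)
      by (auto simp: q_def)
    let ?T = "{v \<in> form_domain M E. ?N v u < \<eta>}"
    have "openin (seminorm_topology M E) ?T"
      unfolding seminorm_topology_def using u(1) \<eta> by (intro topology_generated_by_Basis) blast
    moreover have "u \<in> ?T" using u(1) \<eta> by (simp add: form_norm_diff_self)
    moreover have "?T \<subseteq> (\<lambda>f. f) -` S \<inter> form_domain M E"
    proof
      fix v assume v: "v \<in> ?T"
      hence vL: "v \<in> L0 M" using form_domain_subset by auto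
      have "L0_dist M U v u < r - L0_dist M U w u"
        using small[of "L0_diff M v u"] v u by (simp add: form_domain_diff L0_dist_diff_zero vL U(1))
      moreover have "L0_dist M U w v \<le> L0_dist M U w u + L0_dist M U u v"
        by (rule L0_dist_triangle[OF w u(2) vL U])
      ultimately show "v \<in> (\<lambda>f. f) -` S \<inter> form_domain M E"
        using v vL by (simp add: S L0_dist_commute[of M U u v])
    qed
    ultimately show "\<exists>T. openin (seminorm_topology M E) T \<and> u \<in> T \<and>
        T \<subseteq> (\<lambda>f. f) -` S \<inter> form_domain M E" by blast
  qed
next
  show "(\<lambda>f. f) ` topspace (seminorm_topology M E) \<subseteq>
    \<Union> {{v \<in> L0 M. L0_dist M U u v < r} | u U r.
      u \<in> L0 M \<and> U \<in> sets M \<and> emeasure M U < \<infinity> \<and> 0 < r}"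
    using form_domain_subset topspace_L0_topology[of M]
    by (simp add: topspace_seminorm_topology L0_topology_def)
qed

end

theorem theorem2p28:
  fixes M :: "'a measure" and E :: "('a \<Rightarrow> real) set \<Rightarrow> ennreal"
  assumes "localizable M"
    and "energy_form M E"
  shows "(transient M E \<longleftrightarrow> continuous_map (seminorm_topology M E) (L0_topology M) (\<lambda>f. f)) \<and>
         (continuous_map (seminorm_topology M E) (L0_topology M) (\<lambda>f. f) \<longleftrightarrow>
            real_Hilbert_space_on (form_domain M E) (L0_add M) (L0_scale M) (L0_zero M)
              (form_inner M E))"
proof -
  interpret L0_energy_form M E
    using assms by unfold_locales (auto simp: localizable_def energy_form_def)
  \<comment> \<open>The implications form the cycle (i) to (ii) to (iii) to (i).\<close>
  show ?thesis
    using transient_imp_continuous_embedding continuous_embedding_imp_transient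
      continuous_embedding_imp_Hilbert
      inner_product_space_imp_transient[OF real_Hilbert_space_on.axioms(1)] by argo
qed

end
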